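(* Fix an integer $m \ge 1$, $0 < q \le 1$, and $0 \le r \le 1$ with $r \ne 1/2$ and with $q$ and $r$ not both equal to $1$. Let $\sigma = (2r-1)q$. Let $\mu$ be any probability distribution on $\mathbb{Z}$, and let $(X_n, n\ge 0)$ be $\mathrm{ACM}(m,q,r,\mu)$-distributed. Then, as $n\to\infty$, $$\frac{\operatorname{sign}(\sigma)}{m+1}\left(\frac{m^m}{|\sigma|}\right)^{\frac{1}{m+1}}\cdot\frac{X_n}{n^{1/(m+1)}} \xrightarrow{d} B,$$ where $B$ is $\mathrm{Beta}\left(\frac{m+1}{m},1\right)$-distributed and $\xrightarrow{d}$ denotes convergence in distribution.
   Context: The asymmetric cooperative motion $\mathrm{ACM}(m,q,r,\mu)$ is the law of the process $(X_n,n\ge 0)$ defined as follows. Let $(D_n,n\ge 0)$ be i.i.d. with $\mathbf{P}(D_n=1)=rq$, $\mathbf{P}(D_n=0)=1-q$, $\mathbf{P}(D_n=-1)=(1-r)q$. Let $X_0$ have law $\mu$ (independent of the $D_n$). Given $X_n$, let $\tilde X_n^1,\dots,\tilde X_n^m$ be independent copies of $X_n$ (random variables with the same law as $X_n$, with $X_n,\tilde X_n^1,\dots,\tilde X_n^m,D_n$ mutually independent), and set $X_{n+1}=X_n+D_n$ if $X_n=\tilde X_n^i$ for all $i=1,\dots,m$, and $X_{n+1}=X_n$ otherwise. $\operatorname{sign}(\sigma)=1$ if $\sigma>0$ and $-1$ if $\sigma<0$. The $\mathrm{Beta}(\alpha,1)$ distribution has distribution function $x^\alpha$ on $[0,1]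$.
   Formalization: The case q = 1, r = 0 with μ a point mass at some k is additionally excluded, since there X_n = k − n almost surely and the rescaled variable tends to infinity, so the stated convergence fails. *)

theory Defs
  imports "HOL-Probability.Probability"
begin

text \<open>
  A realisation of the asymmetric cooperative motion on a probability space \<open>N\<close>: \<open>X n\<close> is the
  position at time \<open>n\<close>, \<open>D n\<close> the proposed displacement, and \<open>X' n i\<close> for \<open>1 \<le> i \<le> m\<close> are the
  copies of \<open>X n\<close>. The assumption \<open>indep_X_0_D\<close> says
  that \<open>X 0, D 0, D 1, \<dots>\<close> are mutually independent. In \<open>indep_step\<close> the \<open>m + 2\<close> variables \<open>X n, X' n 1, \<dots>, X' n m, D n\<close> are
  listed with indices \<open>0, 1, \<dots>, m, m + 1\<close>. Independence of the copies from the earlier history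
  is not required.
\<close>

locale acm_realisation = prob_space N
  for N :: "'b measure"
    and m :: nat and q r :: real and \<mu> :: "int pmf"
    and X D :: "nat \<Rightarrow> 'b \<Rightarrow> int" and X' :: "nat \<Rightarrow> nat \<Rightarrow> 'b \<Rightarrow> int" +
  assumes indep_X_0_D: "indep_vars (\<lambda>_. count_space UNIV) (case_nat (X 0) D) UNIV"
    and prob_D_up: "\<And>n. prob {\<omega> \<in> space N. D n \<omega> = 1} = r * q"
    and prob_D_stay: "\<And>n. prob {\<omega> \<in> space N. D n \<omega> = 0} = 1 - q"
    and prob_D_down: "\<And>n. prob {\<omega> \<in> space N. D n \<omega> = -1} = (1 - r) * q"
    and distr_X_0: "distr N (count_space UNIV) (X 0) = measure_pmf \<mu>"
    and distr_copy: "\<And>n i. i \<in> {1..m} \<Longrightarrow>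
          distr N (count_space UNIV) (X' n i) = distr N (count_space UNIV) (X n)"
    and indep_step: "\<And>n. indep_vars (\<lambda>_. count_space UNIV)
          (\<lambda>j. if j = 0 then X n else if j \<le> m then X' n j else D n) {0..m + 1}"
    and X_Suc: "\<And>n \<omega>. \<omega> \<in> space N \<Longrightarrow>
          X (Suc n) \<omega> = (if \<forall>i\<in>{1..m}. X n \<omega> = X' n i \<omega> then X n \<omega> + D n \<omega> else X n \<omega>)"

definition process_law :: "'a measure \<Rightarrow> (nat \<Rightarrow> 'a \<Rightarrow> int) \<Rightarrow> (nat \<Rightarrow> int) measure" where
  "process_law M X = distr M (\<Pi>\<^sub>M n\<in>UNIV. count_space UNIV) (\<lambda>\<omega> n. X n \<omega>)"

definition beta1_cdf :: "real \<Rightarrow> real \<Rightarrow> real" where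
  "beta1_cdf \<alpha> x = (if x \<le> 0 then 0 else if x \<le> 1 then x powr \<alpha> else 1)"

text \<open>The \<open>Beta(\<alpha>, 1)\<close> distribution; meaningful for \<open>\<alpha> > 0\<close>, see \<open>cdf_beta1\<close>.\<close>

definition beta1 :: "real \<Rightarrow> real measure" where
  "beta1 \<alpha> = interval_measure (beta1_cdf \<alpha>)"

lemma beta1_cdf_mono:
  assumes "\<alpha> > 0" "x \<le> y"
  shows "beta1_cdf \<alpha> x \<le> beta1_cdf \<alpha> y"
  using assms by (auto simp: beta1_cdf_def powr_mono2 powr_le1)

lemma isCont_beta1_cdf:
  assumes "\<alpha> > 0"
  shows "isCont (beta1_cdf \<alpha>) x"
proof -
  have eq: "beta1_cdf \<alpha> = (\<lambda>x. max 0 (min x 1) powr \<alpha>)"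
    using assms by (auto simp: beta1_cdf_def fun_eq_iff max_def min_def)
  have "continuous_on UNIV (\<lambda>x. max 0 (min x 1) powr \<alpha>)"
    by (intro continuous_on_powr' continuous_intros) (use assms in auto)
  then show ?thesis
    unfolding eq by (simp add: continuous_on_eq_continuous_at)
qed

lemma beta1_cdf_at_bot: "(beta1_cdf \<alpha> \<longlongrightarrow> 0) at_bot"
  by (rule tendsto_eventually)
    (use eventually_le_at_bot[of 0] in \<open>eventually_elim, simp add: beta1_cdf_def\<close>)

lemma beta1_cdf_at_top: "(beta1_cdf \<alpha> \<longlongrightarrow> 1) at_top"
  by (rule tendsto_eventually)
    (use eventually_gt_at_top[of 1] in \<open>eventually_elim, simp add: beta1_cdf_def\<close>)

lemma cdf_beta1:
  assumes "\<alpha> > 0"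
  shows "cdf (beta1 \<alpha>) = beta1_cdf \<alpha>"
  unfolding beta1_def
  by (rule cdf_interval_measure)
    (use assms in \<open>auto intro: beta1_cdf_mono beta1_cdf_at_bot
      continuous_at_imp_continuous_at_within isCont_beta1_cdf\<close>)

lemma real_distribution_beta1:
  assumes "\<alpha> > 0"
  shows "real_distribution (beta1 \<alpha>)"
  unfolding beta1_def
  by (rule real_distribution_interval_measure)
    (use assms in \<open>auto intro: beta1_cdf_mono beta1_cdf_at_bot beta1_cdf_at_top
      continuous_at_imp_continuous_at_within isCont_beta1_cdf\<close>)

end

theory Submission
  imports Defs "HOL-Real_Asymp.Real_Asymp"
begin

text \<open>
  Write \<open>F n x = P(X n \<le> x)\<close> and \<open>p n x = F n x - F n (x - 1)\<close>. One step of the motion carries the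
  mass \<open>r q p(x)^(m+1)\<close> out of \<open>{..x}\<close> to the right and brings \<open>(1 - r) q p(x + 1)^(m+1)\<close> in from
  \<open>x + 1\<close>, so the distribution functions obey a closed recursion (\<open>acm_step\<close>). It is a discretisation
  of the Hamilton-Jacobi equation \<open>F\<^sub>t + \<sigma> (F\<^sub>x)^(m+1) = 0\<close> plus terms with more space derivatives,
  which vanish on the scale \<open>x \<sim> n^(1/(m+1))\<close>. Reflecting space if necessary, \<open>\<sigma> > 0\<close>. Started from a
  unit mass at the origin, the equation has the self-similar solution
  \<open>min 1 ((C x / t^(1/(m+1)))^\<theta>)\<close> for \<open>x > 0\<close>, with \<open>\<theta> = (m + 1) / m\<close> and the constant \<open>C\<close> of the
  theorem. This is the distribution function of \<open>Beta(\<theta>, 1)\<close>, rescaled. The proof traps \<open>F n\<close> between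
  explicit lattice sub- and supersolutions that converge to this profile.

  Trapping needs a comparison principle. The scheme is not monotone for arbitrary distribution
  functions, but it preserves \<open>F \<le> G\<close> as soon as \<open>q (a + b)^m \<le> 1\<close> whenever \<open>a\<close> and \<open>b\<close> are increments
  of \<open>F\<close> and \<open>G\<close> at the same place (\<open>acm_step_mono\<close>). The barriers are flat, so
  \<open>b\<close> is small. For \<open>q < 1\<close> the factor \<open>q\<close> then gives enough room. For \<open>q = 1\<close> the atoms of \<open>F n\<close>
  must stay away from 1, and they do: the largest atom never grows, and it is smaller than 1 after at
  most one step unless the motion is a deterministic walk (\<open>eventual_headroom\<close>).

  Upper bound. A stationary geometric profile shows that little mass ever drifts far to the left
  (\<open>left_tail_uniform\<close>). To the right of such a point the power profile
  \<open>\<epsilon> + c t^(-1/m) X^\<theta>\<close> is a supersolution for every \<open>c > C^\<theta>\<close>, once \<open>X\<close> is large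
  (\<open>F_le_power_profile\<close>).

  Lower bound. The profile \<open>(C x)^\<theta> t^(-1/m)\<close> is the Legendre transform
  \<open>sup\<^sub>w (w x - \<sigma> w^(m+1) t)\<close>, so it is enough to bound \<open>F\<close> below by each affine wave in this supremum, cut
  off at a level \<open>b < 1\<close>. The cut-off must not leave a kink, because there a lattice subsolution would
  fail; a smooth minimum \<open>softmin\<close>, whose slope changes by a factor close to 1 between neighbouring
  sites, turns the truncated wave into a subsolution (\<open>softmin_wave_subsolution\<close>).
\<close>

section \<open>The recursion for distribution functions and its monotonicity\<close>

text \<open>
  The two correction terms are the masses that cross from \<open>x\<close> to \<open>x + 1\<close> and from \<open>x + 1\<close> to \<open>x\<close>
  in one step.
\<close>

definition acm_step :: "nat \<Rightarrow> real \<Rightarrow> real \<Rightarrow> (int \<Rightarrow> real) \<Rightarrow> int \<Rightarrow> real" where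
  "acm_step m q r F x =
     F x - r * q * (F x - F (x - 1)) ^ (m + 1) + (1 - r) * q * (F (x + 1) - F x) ^ (m + 1)"

text \<open>
  The quotient of the left-hand side by \<open>b - a\<close> is the sum of the \<open>a^i b^(m - i)\<close>, whose
  coefficients are at most the binomial coefficients of \<open>(a + b)^m\<close>.
\<close>

lemma power_Suc_diff_le:
  fixes a b :: real
  assumes "m \<ge> 1" "0 \<le> a" "a \<le> b"
  shows "b ^ (m + 1) - a ^ (m + 1) \<le> (b - a) * (a + b) ^ m"
  using assms(1)
proof (induction m rule: dec_induct)
  case base
  show ?case by (simp add: algebra_simps power2_eq_square)
next
  case (step m)
  have "b ^ (Suc m + 1) - a ^ (Suc m + 1) = b * (b ^ (m + 1) - a ^ (m + 1)) + (b - a) * (a * a ^ m)"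
    by (simp add: algebra_simps)
  also have "\<dots> \<le> b * ((b - a) * (a + b) ^ m) + (b - a) * (a * (a + b) ^ m)"
    using step.IH assms by (intro add_mono mult_left_mono power_mono) auto
  also have "\<dots> = (b - a) * (a + b) ^ Suc m"
    by (simp add: algebra_simps)
  finally show ?case .
qed

lemma power_Suc_diff_bound:
  fixes a b d :: real
  assumes "m \<ge> 1" "0 \<le> a" "0 \<le> b" "b - a \<le> d" "0 \<le> d" "0 \<le> q" "q * (a + b) ^ m \<le> 1"
  shows "q * (b ^ (m + 1) - a ^ (m + 1)) \<le> d"
proof (cases "a \<le> b")
  case True
  have "q * (b ^ (m + 1) - a ^ (m + 1)) \<le> q * ((b - a) * (a + b) ^ m)"
    using power_Suc_diff_le[OF \<open>m \<ge> 1\<close> \<open>0 \<le> a\<close> True] assms by (intro mult_left_mono) auto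
  also have "\<dots> = (b - a) * (q * (a + b) ^ m)" by simp
  also have "\<dots> \<le> (b - a) * 1" using assms True by (intro mult_left_mono) auto
  finally show ?thesis using assms by simp
next
  case False
  then have "b ^ (m + 1) \<le> a ^ (m + 1)" using assms by (intro power_mono) auto
  then have "q * (b ^ (m + 1) - a ^ (m + 1)) \<le> 0" using assms by (intro mult_nonneg_nonpos) auto
  then show ?thesis using assms by linarith
qed

text \<open>
  The comparison principle. With \<open>d = G - F\<close>, both flux terms can lower \<open>d x\<close> by at most their share
  of \<open>d x\<close>: the increments of \<open>F\<close> and \<open>G\<close> at \<open>x\<close> differ by \<open>d x - d (x - 1) \<le> d x\<close>, and those at
  \<open>x + 1\<close> by at least \<open>- d x\<close>; the bound on \<open>q (a + b)^m\<close> converts this to a bound on the fluxes, and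
  the weights \<open>r\<close> and \<open>1 - r\<close> add up to 1. All assumptions are local, so that barriers need to be
  good only near the site in question.
\<close>

lemma acm_step_mono:
  fixes F G :: "int \<Rightarrow> real"
  assumes m: "m \<ge> 1" and q: "0 \<le> q" and r: "0 \<le> r" "r \<le> 1"
    and le: "F (x - 1) \<le> G (x - 1)" "F x \<le> G x" "F (x + 1) \<le> G (x + 1)"
    and F: "F (x - 1) \<le> F x" "F x \<le> F (x + 1)"
    and G: "G (x - 1) \<le> G x" "G x \<le> G (x + 1)"
    and bound: "q * (F x - F (x - 1) + (G x - G (x - 1))) ^ m \<le> 1"
      "q * (F (x + 1) - F x + (G (x + 1) - G x)) ^ m \<le> 1"
  shows "acm_step m q r F x \<le> acm_step m q r G x"
proof -
  have 1: "q * ((G x - G (x - 1)) ^ (m + 1) - (F x - F (x - 1)) ^ (m + 1)) \<le> G x - F x"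
    by (rule power_Suc_diff_bound) (use assms in auto)
  have 2: "q * ((F (x + 1) - F x) ^ (m + 1) - (G (x + 1) - G x) ^ (m + 1)) \<le> G x - F x"
    by (rule power_Suc_diff_bound) (use assms in \<open>auto simp: add.commute\<close>)
  have "r * (q * ((G x - G (x - 1)) ^ (m + 1) - (F x - F (x - 1)) ^ (m + 1))) +
      (1 - r) * (q * ((F (x + 1) - F x) ^ (m + 1) - (G (x + 1) - G x) ^ (m + 1)))
      \<le> r * (G x - F x) + (1 - r) * (G x - F x)"
    using 1 2 r by (intro add_mono mult_left_mono) auto
  then show ?thesis
    by (simp add: acm_step_def algebra_simps)
qed

section \<open>Truncated affine waves\<close>

text \<open>
  A smooth concave minimum of \<open>\<xi>\<close> and \<open>b\<close>; it equals
  \<open>- ln (exp (- \<kappa> \<xi>) + exp (- \<kappa> b)) / \<kappa>\<close> and tends to \<open>min \<xi> b\<close> as \<open>\<kappa>\<close> grows.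
\<close>

definition softmin :: "real \<Rightarrow> real \<Rightarrow> real \<Rightarrow> real" where
  "softmin \<kappa> b \<xi> = b - ln (1 + exp (\<kappa> * (b - \<xi>))) / \<kappa>"

text \<open>
  The derivative of \<open>softmin \<kappa> b\<close>.
\<close>

definition softmin_slope :: "real \<Rightarrow> real \<Rightarrow> real \<Rightarrow> real" where
  "softmin_slope \<kappa> b \<xi> = exp (\<kappa> * (b - \<xi>)) / (1 + exp (\<kappa> * (b - \<xi>)))"

lemma one_plus_exp_pos: "0 < 1 + exp (u::real)"
  by (simp add: add_pos_pos)

lemma softmin_slope_bounds: "0 \<le> softmin_slope \<kappa> b \<xi>" "softmin_slope \<kappa> b \<xi> \<le> 1"
  using one_plus_exp_pos[of "\<kappa> * (b - \<xi>)"] by (auto simp: softmin_slope_def field_simps)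

text \<open>
  Concavity: the graph lies below its tangents. After exponentiation this is convexity of \<open>exp\<close>
  between \<open>0\<close> and \<open>- \<kappa> h\<close>, with the slope as weight.
\<close>

lemma softmin_tangent:
  assumes "\<kappa> > 0"
  shows "softmin \<kappa> b (\<xi> + h) \<le> softmin \<kappa> b \<xi> + h * softmin_slope \<kappa> b \<xi>"
proof -
  define a w where "a = exp (\<kappa> * (b - \<xi>))" and "w = a / (1 + a)"
  have a: "a > 0" by (simp add: a_def)
  have w: "0 \<le> w" "w \<le> 1" using a by (auto simp: w_def)
  have shift: "exp (\<kappa> * (b - (\<xi> + h))) = a * exp (- \<kappa> * h)"
    by (simp add: a_def algebra_simps flip: exp_add)
  have "exp ((1 - w) *\<^sub>R 0 + w *\<^sub>R (- \<kappa> * h)) \<le> (1 - w) * exp 0 + w * exp (- \<kappa> * h)"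
    by (rule convex_onD[OF exp_convex]) (use w in auto)
  also have "\<dots> = (1 + a * exp (- \<kappa> * h)) / (1 + a)"
    using a by (simp add: w_def field_simps)
  finally have "exp (- \<kappa> * h * w) \<le> (1 + a * exp (- \<kappa> * h)) / (1 + a)"
    by (simp add: mult.commute)
  then have "- \<kappa> * h * w \<le> ln ((1 + a * exp (- \<kappa> * h)) / (1 + a))"
    using a by (subst ln_ge_iff) (auto intro!: divide_pos_pos add_pos_pos)
  also have "\<dots> = ln (1 + a * exp (- \<kappa> * h)) - ln (1 + a)"
    using a add_pos_pos[of 1 "a * exp (- \<kappa> * h)"] by (subst ln_div) auto
  finally have "(ln (1 + a) - \<kappa> * h * w) / \<kappa> \<le> ln (1 + a * exp (- \<kappa> * h)) / \<kappa>"
    using assms by (intro divide_right_mono) auto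
  then have "ln (1 + a) / \<kappa> - h * w \<le> ln (1 + a * exp (- \<kappa> * h)) / \<kappa>"
    using assms by (simp add: diff_divide_distrib)
  moreover have "softmin_slope \<kappa> b \<xi> = w" by (simp add: softmin_slope_def w_def a_def)
  moreover have "softmin \<kappa> b \<xi> = b - ln (1 + a) / \<kappa>" by (simp add: softmin_def a_def)
  moreover have "softmin \<kappa> b (\<xi> + h) = b - ln (1 + a * exp (- \<kappa> * h)) / \<kappa>"
    unfolding softmin_def shift ..
  ultimately show ?thesis by simp
qed

text \<open>
  The logarithmic derivative of the slope lies in \<open>{-\<kappa>..0}\<close>.
\<close>

lemma softmin_slope_Harnack:
  assumes "\<kappa> > 0" "h \<ge> 0"
  shows "softmin_slope \<kappa> b (\<xi> - h) \<le> exp (\<kappa> * h) * softmin_slope \<kappa> b \<xi>"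
proof -
  define a e where "a = exp (\<kappa> * (b - \<xi>))" and "e = exp (\<kappa> * h)"
  have a: "a > 0" "e \<ge> 1" using assms by (auto simp: a_def e_def)
  have "exp (\<kappa> * (b - (\<xi> - h))) = a * e"
    by (simp add: a_def e_def algebra_simps flip: exp_add)
  then have "softmin_slope \<kappa> b (\<xi> - h) = a * e / (1 + a * e)"
    by (simp only: softmin_slope_def)
  also have "\<dots> \<le> a * e / (1 + a)"
    using a by (intro divide_left_mono) (auto intro!: mult_pos_pos add_pos_pos)
  also have "\<dots> = e * softmin_slope \<kappa> b \<xi>" by (simp add: softmin_slope_def a_def)
  finally show ?thesis by (simp add: e_def)
qed

lemma softmin_increment:
  assumes "\<kappa> > 0" "h \<ge> 0"
  shows "softmin \<kappa> b \<xi> \<le> softmin \<kappa> b (\<xi> + h)" "softmin \<kappa> b (\<xi> + h) \<le> softmin \<kappa> b \<xi> + h"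
proof -
  have "softmin \<kappa> b (\<xi> + h + - h) \<le> softmin \<kappa> b (\<xi> + h) + - h * softmin_slope \<kappa> b (\<xi> + h)"
    by (rule softmin_tangent) fact
  moreover have "0 \<le> h * softmin_slope \<kappa> b (\<xi> + h)"
    using assms softmin_slope_bounds by (intro mult_nonneg_nonneg) auto
  ultimately show "softmin \<kappa> b \<xi> \<le> softmin \<kappa> b (\<xi> + h)" by simp
  have "softmin \<kappa> b (\<xi> + h) \<le> softmin \<kappa> b \<xi> + h * softmin_slope \<kappa> b \<xi>"
    by (rule softmin_tangent) fact
  also have "h * softmin_slope \<kappa> b \<xi> \<le> h"
    using assms softmin_slope_bounds by (intro mult_left_le) auto
  finally show "softmin \<kappa> b (\<xi> + h) \<le> softmin \<kappa> b \<xi> + h" by simp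
qed

lemma softmin_le:
  assumes "\<kappa> > 0"
  shows "softmin \<kappa> b \<xi> \<le> b" "softmin \<kappa> b \<xi> \<le> \<xi>"
proof -
  show "softmin \<kappa> b \<xi> \<le> b"
    using assms by (auto simp: softmin_def intro!: divide_nonneg_pos ln_ge_zero)
  have "\<kappa> * (b - \<xi>) \<le> ln (1 + exp (\<kappa> * (b - \<xi>)))"
    by (subst ln_ge_iff) (auto simp: one_plus_exp_pos)
  then have "b - \<xi> \<le> ln (1 + exp (\<kappa> * (b - \<xi>))) / \<kappa>"
    using assms by (simp add: pos_le_divide_eq mult.commute)
  then show "softmin \<kappa> b \<xi> \<le> \<xi>" by (simp add: softmin_def)
qed

lemma softmin_ge:
  assumes "\<kappa> > 0"
  shows "min \<xi> b - ln 2 / \<kappa> \<le> softmin \<kappa> b \<xi>"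
proof -
  have "1 + exp (\<kappa> * (b - \<xi>)) \<le> 2 * exp (\<kappa> * (b - min \<xi> b))"
  proof (cases "\<xi> \<le> b")
    case True
    then have "1 \<le> exp (\<kappa> * (b - \<xi>))" using assms by simp
    then show ?thesis using True by simp
  next
    case False
    then have "exp (\<kappa> * (b - \<xi>)) \<le> 1" using assms by (simp add: mult_le_0_iff)
    then show ?thesis using False by (simp add: min_def)
  qed
  then have "ln (1 + exp (\<kappa> * (b - \<xi>))) \<le> ln (2 * exp (\<kappa> * (b - min \<xi> b)))"
    by (subst ln_le_cancel_iff) (auto simp: one_plus_exp_pos)
  also have "\<dots> = ln 2 + \<kappa> * (b - min \<xi> b)" by (simp add: ln_mult)
  finally have "ln (1 + exp (\<kappa> * (b - \<xi>))) / \<kappa> \<le> (ln 2 + \<kappa> * (b - min \<xi> b)) / \<kappa>"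
    using assms by (intro divide_right_mono) auto
  then show ?thesis using assms by (simp add: softmin_def add_divide_distrib)
qed

lemma isCont_softmin: "isCont (softmin \<kappa> b) \<xi>"
proof -
  have "1 + exp (\<kappa> * (b - \<xi>)) \<noteq> 0" using one_plus_exp_pos by (metis less_irrefl)
  then show ?thesis unfolding softmin_def by (cases "\<kappa> = 0") (auto intro!: continuous_intros)
qed

text \<open>
  Why the truncated wave is a subsolution: let \<open>s \<le> 1\<close> be its slope at \<open>\<xi>\<close>. By concavity and the
  Harnack bound the backward and forward increments are at most \<open>w exp (\<kappa> w) s\<close> and at least
  \<open>w exp (- \<kappa> w) s\<close>, so the net flux out is at most \<open>v w^(m+1) s^(m+1)\<close>, and the wave itself
  retreats by at least \<open>v w^(m+1) s\<close>. The former is the smaller one because \<open>s^(m+1) \<le> s\<close>.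
\<close>

lemma softmin_wave_subsolution:
  fixes m :: nat and \<kappa> w b \<alpha> \<beta> v :: real
  assumes "\<kappa> > 0" "w > 0" and \<alpha>: "0 \<le> \<alpha>" and \<beta>: "0 \<le> \<beta>" and "0 \<le> v"
    and v: "\<alpha> * exp (\<kappa> * w) ^ (m + 1) - \<beta> / exp (\<kappa> * w) ^ (m + 1) \<le> v"
  defines "g \<equiv> softmin \<kappa> b"
  shows "g (\<xi> - v * w ^ (m + 1))
    \<le> g \<xi> - \<alpha> * (g \<xi> - g (\<xi> - w)) ^ (m + 1) + \<beta> * (g (\<xi> + w) - g \<xi>) ^ (m + 1)"
proof -
  define E s where "E = exp (\<kappa> * w)" and "s = softmin_slope \<kappa> b \<xi>"
  have E: "E > 0" by (simp add: E_def)
  have s: "0 \<le> s" "s \<le> 1" using softmin_slope_bounds by (auto simp: s_def)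
  have "g (\<xi> - w + w) \<le> g (\<xi> - w) + w * softmin_slope \<kappa> b (\<xi> - w)"
    unfolding g_def by (rule softmin_tangent) fact
  also have "w * softmin_slope \<kappa> b (\<xi> - w) \<le> w * (E * s)"
    unfolding E_def s_def using assms by (intro mult_left_mono softmin_slope_Harnack) auto
  finally have left: "g \<xi> - g (\<xi> - w) \<le> w * (E * s)" by simp
  have "g (\<xi> + w + - w) \<le> g (\<xi> + w) + - w * softmin_slope \<kappa> b (\<xi> + w)"
    unfolding g_def by (rule softmin_tangent) fact
  moreover have "s \<le> E * softmin_slope \<kappa> b (\<xi> + w)"
    using softmin_slope_Harnack[of \<kappa> w b "\<xi> + w"] assms by (simp add: E_def s_def)
  then have "w * (s / E) \<le> w * softmin_slope \<kappa> b (\<xi> + w)"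
    using E assms by (intro mult_left_mono) (auto simp: field_simps)
  ultimately have right: "w * (s / E) \<le> g (\<xi> + w) - g \<xi>" by simp
  have "0 \<le> g \<xi> - g (\<xi> - w)"
    using softmin_increment(1)[of \<kappa> w b "\<xi> - w"] assms by (simp add: g_def)
  then have "\<alpha> * (g \<xi> - g (\<xi> - w)) ^ (m + 1) \<le> \<alpha> * (w * (E * s)) ^ (m + 1)"
    using left \<alpha> by (intro mult_left_mono power_mono)
  moreover have "\<beta> * (w * (s / E)) ^ (m + 1) \<le> \<beta> * (g (\<xi> + w) - g \<xi>) ^ (m + 1)"
    using right \<beta> s E assms by (intro mult_left_mono power_mono) auto
  moreover have "\<alpha> * (w * (E * s)) ^ (m + 1) - \<beta> * (w * (s / E)) ^ (m + 1)
      = (\<alpha> * E ^ (m + 1) - \<beta> / E ^ (m + 1)) * (s ^ (m + 1) * w ^ (m + 1))"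
    using E by (simp add: power_mult_distrib power_divide field_simps del: power_Suc)
  moreover have "(\<alpha> * E ^ (m + 1) - \<beta> / E ^ (m + 1)) * (s ^ (m + 1) * w ^ (m + 1))
      \<le> v * (s * w ^ (m + 1))"
  proof (intro mult_mono)
    show "s ^ (m + 1) \<le> s" using s by (simp add: mult_left_le power_le_one)
  qed (use v s assms E in \<open>auto simp: E_def\<close>)
  moreover have "g (\<xi> + - (v * w ^ (m + 1))) \<le> g \<xi> + - (v * w ^ (m + 1)) * s"
    unfolding g_def s_def by (rule softmin_tangent) fact
  ultimately show ?thesis by (simp add: mult.assoc mult.left_commute mult.commute)
qed

section \<open>The self-similar power profile on the lattice\<close>

lemma powr_increment:
  fixes y :: real
  assumes "m \<ge> 1" "y > 0"
  obtains z where "y < z" "z < y + 1"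
    "(y + 1) powr ((real m + 1) / real m) - y powr ((real m + 1) / real m)
      = (real m + 1) / real m * z powr (1 / real m)"
proof -
  define p where "p = (real m + 1) / real m"
  have p: "p - 1 = 1 / real m" using assms by (simp add: p_def field_simps)
  have "\<exists>z>y. z < y + 1 \<and> (y + 1) powr p - y powr p = (y + 1 - y) * (p * z powr (p - 1))"
    using assms by (intro MVT2) (auto intro!: derivative_eq_intros simp: powr_diff)
  then obtain z where "y < z" "z < y + 1" "(y + 1) powr p - y powr p = p * z powr (1 / real m)"
    using p by auto
  then show thesis using that unfolding p_def by blast
qed

lemma powr_decay_increment:
  fixes t :: real
  assumes "m \<ge> 1" "t > 0"
  shows "t powr (- 1 / real m) - 1 / real m * t powr (- (real m + 1) / real m)
    \<le> (t + 1) powr (- 1 / real m)"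
proof -
  define p where "p = - 1 / real m"
  have p: "p - 1 = - (real m + 1) / real m" using assms by (simp add: p_def field_simps)
  have "\<exists>z>t. z < t + 1 \<and> (t + 1) powr p - t powr p = (t + 1 - t) * (p * z powr (p - 1))"
    using assms by (intro MVT2) (auto intro!: derivative_eq_intros simp: powr_diff)
  then obtain z where z: "z > t" "(t + 1) powr p - t powr p = p * z powr (p - 1)" by auto
  have "z powr (p - 1) \<le> t powr (p - 1)"
    using z assms by (intro powr_mono2') (auto simp: p_def intro: order_trans[of _ 0])
  then have "1 / real m * z powr (p - 1) \<le> 1 / real m * t powr (p - 1)"
    by (intro mult_left_mono) auto
  moreover have "p * z powr (p - 1) = - (1 / real m * z powr (p - 1))" by (simp add: p_def)
  ultimately have "t powr p - 1 / real m * t powr (p - 1) \<le> (t + 1) powr p"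
    using z by linarith
  then show ?thesis unfolding p by (simp only: p_def)
qed

text \<open>
  For \<open>g t X = c t^(-1/m) X^p\<close> the decay in time and both fluxes carry the same power
  \<open>t^(- p)\<close> of time, so that the inequality reduces to the condition \<open>X_large\<close> on \<open>X\<close> alone.
\<close>

lemma power_profile_supersolution:
  fixes m :: nat and c \<alpha> \<beta> X t :: real
  assumes m: "m \<ge> 1" and X: "X > 1" and t: "t > 0" and c: "c > 0" and \<alpha>: "0 \<le> \<alpha>" and \<beta>: "0 \<le> \<beta>"
  defines "p \<equiv> (real m + 1) / real m"
  defines "g \<equiv> (\<lambda>t X. c * t powr (- 1 / real m) * X powr p)"
  assumes X_large: "X powr p
      \<le> real m * p ^ (m + 1) * c ^ m * (\<alpha> * (X - 1) powr p - \<beta> * (X + 1) powr p)"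
  shows "g t X - \<alpha> * (g t X - g t (X - 1)) ^ (m + 1) + \<beta> * (g t (X + 1) - g t X) ^ (m + 1)
    \<le> g (t + 1) X"
proof -
  define T where "T = t powr (- (real m + 1) / real m)"
  have p: "p > 0" using m by (simp add: p_def)
  have pow: "(z powr (1 / real m)) ^ (m + 1) = z powr p" if "z > 0" for z :: real
    using that m by (subst powr_power) (auto simp: p_def add_ac)
  have powt: "(t powr (- 1 / real m)) ^ (m + 1) = T"
  proof -
    have "real (m + 1) * (- 1 / real m) = - (real m + 1) / real m"
      using m by (simp add: field_simps)
    then show ?thesis using t unfolding T_def by (subst powr_power) auto
  qed
  have incr: "(c * t powr (- 1 / real m) * (p * z powr (1 / real m))) ^ (m + 1)
      = (c * p) ^ (m + 1) * T * z powr p" if "z > 0" for z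
    using pow[OF that] powt by (simp only: power_mult_distrib mult_ac)
  obtain z1 where z1: "X - 1 < z1" "X powr p - (X - 1) powr p = p * z1 powr (1 / real m)"
    using powr_increment[OF m, of "X - 1"] X unfolding p_def by auto
  obtain z2 where z2: "X < z2" "z2 < X + 1" "(X + 1) powr p - X powr p = p * z2 powr (1 / real m)"
    using powr_increment[OF m, of X] X unfolding p_def by auto
  have "(c * p) ^ (m + 1) * T * (X - 1) powr p \<le> (c * p) ^ (m + 1) * T * z1 powr p"
    using z1 X c p by (intro mult_left_mono powr_mono2) (auto simp: T_def)
  also have "\<dots> = (g t X - g t (X - 1)) ^ (m + 1)"
    using incr[of z1] z1 X by (simp only: g_def flip: right_diff_distrib)
  finally have left: "\<alpha> * ((c * p) ^ (m + 1) * T * (X - 1) powr p)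
      \<le> \<alpha> * (g t X - g t (X - 1)) ^ (m + 1)" using \<alpha> by (intro mult_left_mono)
  have "(g t (X + 1) - g t X) ^ (m + 1) = (c * p) ^ (m + 1) * T * z2 powr p"
    using incr[of z2] z2 X by (simp only: g_def flip: right_diff_distrib)
  also have "\<dots> \<le> (c * p) ^ (m + 1) * T * (X + 1) powr p"
    using z2 X c p by (intro mult_left_mono powr_mono2) (auto simp: T_def)
  finally have right: "\<beta> * (g t (X + 1) - g t X) ^ (m + 1)
      \<le> \<beta> * ((c * p) ^ (m + 1) * T * (X + 1) powr p)" using \<beta> by (intro mult_left_mono)
  have "c / real m * T * X powr p \<le> c / real m * T *
      (real m * p ^ (m + 1) * c ^ m * (\<alpha> * (X - 1) powr p - \<beta> * (X + 1) powr p))"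
    using X_large c by (intro mult_left_mono) (auto simp: T_def)
  also have "\<dots> = \<alpha> * ((c * p) ^ (m + 1) * T * (X - 1) powr p)
      - \<beta> * ((c * p) ^ (m + 1) * T * (X + 1) powr p)"
    using m by (simp add: power_mult_distrib field_simps)
  finally have loss: "c / real m * T * X powr p \<le> \<dots>" .
  have "c * X powr p * (t powr (- 1 / real m) - 1 / real m * T)
      \<le> c * X powr p * (t + 1) powr (- 1 / real m)"
    using powr_decay_increment[OF m t] c by (intro mult_left_mono) (auto simp: T_def)
  then have "g t X - c / real m * T * X powr p \<le> g (t + 1) X"
    by (simp add: g_def algebra_simps)
  then show ?thesis using left right loss by linarith
qed

text \<open>
  Shifting \<open>X\<close> by 1 changes \<open>X powr p\<close> by a factor that tends to 1, hence the strict inequality between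
  the leading coefficients decides.
\<close>

lemma eventually_power_profile_large:
  fixes \<alpha> \<beta> B p :: real
  assumes "B > 0" "B * (\<alpha> - \<beta>) > 1"
  shows "\<forall>\<^sub>F X in at_top. X powr p \<le> B * (\<alpha> * (X - 1) powr p - \<beta> * (X + 1) powr p)"
proof -
  have "((\<lambda>X::real. ((X - 1) / X) powr p) \<longlongrightarrow> 1) at_top" "((\<lambda>X::real. ((X + 1) / X) powr p) \<longlongrightarrow> 1) at_top"
    by real_asymp+
  then have "((\<lambda>X::real. B * (\<alpha> * ((X - 1) / X) powr p - \<beta> * ((X + 1) / X) powr p)) \<longlongrightarrow> B * (\<alpha> * 1 - \<beta> * 1)) at_top"
    by (intro tendsto_intros)
  then have "\<forall>\<^sub>F X in at_top. B * (\<alpha> * ((X - 1) / X) powr p - \<beta> * ((X + 1) / X) powr p) > 1"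
    using assms by (intro order_tendstoD) auto
  then show ?thesis
    using eventually_gt_at_top[of 1]
  proof eventually_elim
    case (elim X)
    then have "X powr p * 1 \<le> X powr p * (B * (\<alpha> * ((X - 1) / X) powr p - \<beta> * ((X + 1) / X) powr p))"
      by (intro mult_left_mono) auto
    also have "\<dots> = B * (\<alpha> * (X - 1) powr p - \<beta> * (X + 1) powr p)"
      using elim by (simp add: powr_divide field_simps)
    finally show ?case by simp
  qed
qed

text \<open>
  Below height 1 the increments of the profile are of order \<open>1 / X\<close>; this keeps the barrier flat where
  it is compared with a distribution function.
\<close>

lemma power_profile_increments:
  fixes m :: nat and c X t :: real
  assumes m: "m \<ge> 1" and X: "X > 1" and t: "t \<ge> 1" and c: "c > 0"
  defines "p \<equiv> (real m + 1) / real m"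
  defines "g \<equiv> (\<lambda>t X. c * t powr (- 1 / real m) * X powr p)"
  assumes le_1: "g (t + 1) X \<le> 1"
  shows "g t X - g t (X - 1) \<le> 4 * p / X" "g t (X + 1) - g t X \<le> 4 * p / X"
proof -
  have p: "p > 0" "p - 1 = 1 / real m" using m by (auto simp: p_def field_simps)
  have half: "x powr (1 / real m) \<le> 2 * y powr (1 / real m)" if "0 \<le> x" "x \<le> 2 * y" for x y :: real
  proof -
    have "x powr (1 / real m) \<le> (2 * y) powr (1 / real m)"
      using that by (intro powr_mono2) auto
    also have "\<dots> = 2 powr (1 / real m) * y powr (1 / real m)"
      using that by (subst powr_mult) auto
    also have "\<dots> \<le> 2 powr 1 * y powr (1 / real m)"
      using m by (intro mult_right_mono powr_mono) auto
    finally show ?thesis by simp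
  qed
  have "(t + 1) powr (1 / real m) \<le> 2 * t powr (1 / real m)" using t by (intro half) auto
  then have "t powr (- 1 / real m) \<le> 2 * (t + 1) powr (- 1 / real m)"
    using t by (simp add: powr_minus field_simps)
  then have "c * t powr (- 1 / real m) * X powr p \<le> c * (2 * (t + 1) powr (- 1 / real m)) * X powr p"
    using c by (intro mult_right_mono mult_left_mono) auto
  then have g2: "g t X \<le> 2" using le_1 by (simp add: g_def)
  have *: "c * t powr (- 1 / real m) * (p * z powr (1 / real m)) \<le> 4 * p / X"
    if z: "0 < z" "z < X + 1" for z
  proof -
    have "c * t powr (- 1 / real m) * (p * z powr (1 / real m))
        \<le> c * t powr (- 1 / real m) * (p * (2 * X powr (1 / real m)))"
      using c p z X by (intro mult_left_mono half) auto
    also have "X powr (1 / real m) = X powr p / X"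
      using X by (simp add: powr_diff flip: p)
    also have "c * t powr (- 1 / real m) * (p * (2 * (X powr p / X))) = g t X * (2 * p / X)"
      by (simp add: g_def)
    also have "\<dots> \<le> 2 * (2 * p / X)"
      using g2 p X by (intro mult_right_mono) auto
    finally show ?thesis by simp
  qed
  obtain z1 where z1: "X - 1 < z1" "z1 < X" "X powr p - (X - 1) powr p = p * z1 powr (1 / real m)"
    using powr_increment[OF m, of "X - 1"] X unfolding p_def by auto
  obtain z2 where z2: "X < z2" "z2 < X + 1" "(X + 1) powr p - X powr p = p * z2 powr (1 / real m)"
    using powr_increment[OF m, of X] X unfolding p_def by auto
  show "g t X - g t (X - 1) \<le> 4 * p / X"
    using *[of z1] z1 X by (simp only: g_def flip: right_diff_distrib)
  show "g t (X + 1) - g t X \<le> 4 * p / X"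
    using *[of z2] z2 X by (simp only: g_def flip: right_diff_distrib)
qed

section \<open>Room for the comparison principle\<close>

text \<open>
  The recursion abstracted from the process: \<open>F n\<close> is the distribution function of the position at
  time \<open>n\<close>, with the drift normalised to point to the right. The last assumption excludes the walk
  that moves one step to the right at every time from a deterministic start.
\<close>

locale acm_cdf =
  fixes m :: nat and q r :: real and F :: "nat \<Rightarrow> int \<Rightarrow> real"
  assumes m: "m \<ge> 1" and q: "0 < q" "q \<le> 1" and r: "1 / 2 < r" "r \<le> 1"
    and F_mono: "mono (F n)"
    and F_bot: "(F n \<longlongrightarrow> 0) at_bot"
    and F_top: "(F n \<longlongrightarrow> 1) at_top"
    and F_Suc: "F (Suc n) x = acm_step m q r (F n) x"
    and not_frozen: "\<not> (q = 1 \<and> r = 1 \<and> (\<exists>k. \<forall>x. F 0 x = (if x < k then 0 else 1)))"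
begin

definition \<sigma> :: real where "\<sigma> = (2 * r - 1) * q"
definition \<theta> :: real where "\<theta> = (real m + 1) / real m"

lemma F_monoD: "x \<le> y \<Longrightarrow> F n x \<le> F n y"
  using F_mono by (auto dest: monoD)

lemma F_nonneg: "0 \<le> F n x"
proof (rule tendsto_upperbound[OF F_bot])
  show "\<forall>\<^sub>F y in at_bot. F n y \<le> F n x"
    using eventually_le_at_bot[of x] by eventually_elim (rule F_monoD)
qed simp

lemma F_le_1: "F n x \<le> 1"
proof (rule tendsto_lowerbound[OF F_top])
  show "\<forall>\<^sub>F y in at_top. F n x \<le> F n y"
    using eventually_ge_at_top[of x] by eventually_elim (rule F_monoD)
qed simp

text \<open>
  The new atom at \<open>x\<close> is the old one plus exchange terms with its two neighbours. As two neighbouring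
  atoms have total mass at most 1, each term is at most its share \<open>r\<close> or \<open>1 - r\<close> of the gap \<open>M - s\<close>.
\<close>

lemma jump_bound_Suc:
  assumes "\<And>x. F n x - F n (x - 1) \<le> M"
  shows "F (Suc n) x - F (Suc n) (x - 1) \<le> M"
proof -
  define s a b where "s = F n x - F n (x - 1)" and "a = F n (x - 1) - F n (x - 2)"
    and "b = F n (x + 1) - F n x"
  have nn: "0 \<le> s" "0 \<le> a" "0 \<le> b" by (auto simp: s_def a_def b_def F_monoD)
  have "F n x - F n (x - 2) \<le> 1" "F n (x + 1) - F n (x - 1) \<le> 1"
    using F_nonneg[of n "x - 2"] F_le_1[of n x] F_nonneg[of n "x - 1"] F_le_1[of n "x + 1"] by auto
  then have sum: "s + a \<le> 1" "s + b \<le> 1" by (auto simp: s_def a_def b_def)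
  have "s \<le> M" "a \<le> M" "b \<le> M"
    using assms[of x] assms[of "x - 1"] assms[of "x + 1"] by (auto simp: s_def a_def b_def)
  note le = this
  have pow: "q * (s + a) ^ m \<le> 1" "q * (s + b) ^ m \<le> 1"
    using sum nn q by (auto intro!: mult_le_one power_le_one)
  have 1: "q * (a ^ (m + 1) - s ^ (m + 1)) \<le> M - s"
    by (rule power_Suc_diff_bound) (use m nn le q pow in auto)
  have 2: "q * (b ^ (m + 1) - s ^ (m + 1)) \<le> M - s"
    by (rule power_Suc_diff_bound) (use m nn le q pow in auto)
  have "r * (q * (a ^ (m + 1) - s ^ (m + 1))) + (1 - r) * (q * (b ^ (m + 1) - s ^ (m + 1)))
      \<le> r * (M - s) + (1 - r) * (M - s)"
    using 1 2 r by (intro add_mono mult_left_mono) auto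
  moreover have "F (Suc n) x - F (Suc n) (x - 1) = s + r * (q * (a ^ (m + 1) - s ^ (m + 1)))
      + (1 - r) * (q * (b ^ (m + 1) - s ^ (m + 1)))"
    by (simp add: F_Suc acm_step_def s_def a_def b_def algebra_simps)
  ultimately show ?thesis by (simp add: algebra_simps)
qed

lemma jump_bound_le:
  assumes "\<And>x. F n0 x - F n0 (x - 1) \<le> M" "n0 \<le> n"
  shows "F n x - F n (x - 1) \<le> M"
  using assms(2)
  by (induction n arbitrary: x rule: dec_induct) (auto intro: assms(1) jump_bound_Suc)

text \<open>
  At most one atom exceeds \<open>1/2\<close>, so the supremum of the atoms is below 1 unless one of them is 1.
\<close>

lemma jump_bound_or_frozen:
  shows "(\<exists>M<1. \<forall>x. F n x - F n (x - 1) \<le> M) \<or> (\<exists>k. \<forall>x. F n x = (if x < k then 0 else 1))"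
proof (cases "\<exists>k. F n k - F n (k - 1) > 1 / 2")
  case False
  then show ?thesis by (intro disjI1 exI[of _ "1 / 2"]) (auto simp: not_less)
next
  case True
  then obtain k where k: "F n k - F n (k - 1) > 1 / 2" by auto
  show ?thesis
  proof (cases "F n k - F n (k - 1) < 1")
    case True
    have "F n x - F n (x - 1) \<le> F n k - F n (k - 1)" for x
    proof -
      consider "x < k" | "x = k" | "x > k" by linarith
      then show ?thesis
      proof cases
        case 1
        then have "F n x \<le> F n (k - 1)" by (intro F_monoD) auto
        then show ?thesis using k F_nonneg[of n "x - 1"] F_le_1[of n k] by linarith
      next
        case 3
        then have "F n k \<le> F n (x - 1)" by (intro F_monoD) auto
        then show ?thesis using k F_nonneg[of n "k - 1"] F_le_1[of n x] by linarith
      qed simp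
    qed
    then show ?thesis using True by blast
  next
    case False
    have "F n x = (if x < k then 0 else 1)" for x
      using False F_nonneg[of n "k - 1"] F_le_1[of n k] F_monoD[of x "k - 1" n] F_monoD[of k x n]
        F_nonneg[of n x] F_le_1[of n x]
      by (auto simp: not_less)
    then show ?thesis by blast
  qed
qed

text \<open>
  This is the bound that the comparison principle asks for, for barriers with increments at most \<open>\<delta>\<close>.
  For \<open>q < 1\<close> it holds from the start. For \<open>q = 1\<close> a deterministic start must first be
  split in two by one step, which is possible because \<open>r < 1\<close> then.
\<close>

lemma eventual_headroom:
  "\<exists>n0. \<exists>\<delta>>0. \<forall>n\<ge>n0. \<forall>x. q * (F n x - F n (x - 1) + \<delta>) ^ m \<le> 1"
proof (cases "q < 1")
  case True
  have "((\<lambda>\<delta>. q * (1 + \<delta>) ^ m) \<longlongrightarrow> q * (1 + 0) ^ m) (at_right 0)"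
    by (intro tendsto_intros)
  then have "\<forall>\<^sub>F \<delta> in at_right 0. q * (1 + \<delta>) ^ m < 1"
    using True by (intro order_tendstoD) auto
  then have "\<forall>\<^sub>F \<delta> in at_right 0. q * (1 + \<delta>) ^ m < 1 \<and> \<delta> > (0::real)"
    using eventually_at_right_less by eventually_elim auto
  then obtain \<delta> :: real where \<delta>: "q * (1 + \<delta>) ^ m < 1" "\<delta> > 0"
    using eventually_happens' trivial_limit_at_right_real by blast
  have "q * (F n x - F n (x - 1) + \<delta>) ^ m \<le> 1" for n x
  proof -
    have "q * (F n x - F n (x - 1) + \<delta>) ^ m \<le> q * (1 + \<delta>) ^ m"
      using F_nonneg[of n "x - 1"] F_le_1[of n x] F_monoD[of "x - 1" x n] q \<delta>
      by (intro mult_left_mono power_mono) auto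
    then show ?thesis using \<delta> by simp
  qed
  then show ?thesis using \<delta> by blast
next
  case False
  then have q1: "q = 1" using q by simp
  have "\<exists>n0. \<exists>M<1. \<forall>x. F n0 x - F n0 (x - 1) \<le> M"
  proof (cases "\<exists>k. \<forall>x. F 0 x = (if x < k then 0 else 1)")
    case False
    then show ?thesis using jump_bound_or_frozen by blast
  next
    case True
    then obtain k where k: "\<And>x. F 0 x = (if x < k then 0 else 1)" by auto
    have "r < 1" using not_frozen q1 True r by force
    \<comment> \<open>From a unit mass at \<open>k\<close> the first step leads to mass \<open>r\<close> at \<open>k + 1\<close> and \<open>1 - r\<close> at \<open>k - 1\<close>.\<close>
    moreover have "F 1 x - F 1 (x - 1) \<le> r" for x
      using F_Suc[of 0 x] F_Suc[of 0 "x - 1"] r q1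
      by (auto simp: acm_step_def k)
    ultimately show ?thesis by blast
  qed
  then obtain n0 M where M: "M < 1" "\<And>x. F n0 x - F n0 (x - 1) \<le> M" by auto
  have "q * (F n x - F n (x - 1) + (1 - M)) ^ m \<le> 1" if "n0 \<le> n" for n x
    using jump_bound_le[OF M(2) that, of x] q1 M(1) F_monoD[of "x - 1" x n]
    by (auto intro!: power_le_one)
  then show ?thesis using M(1) by (intro exI[of _ n0] exI[of _ "1 - M"]) auto
qed

section \<open>Comparison with sub- and supersolutions\<close>

lemma sigma_pos: "\<sigma> > 0" using q r by (simp add: \<sigma>_def)

lemma sigma_eq: "r * q - (1 - r) * q = \<sigma>" by (simp add: \<sigma>_def algebra_simps)

text \<open>
  The supersolution property is demanded only at sites where the bound at the next time is not already
  known for another reason (because the barrier exceeds 1, or because the site lies in the left tail).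
\<close>

lemma F_le_supersolution:
  assumes headroom: "\<And>n x. n0 \<le> n \<Longrightarrow> q * (F n x - F n (x - 1) + \<delta>) ^ m \<le> 1"
    and init: "\<And>x. F n0 x \<le> G n0 x"
    and super: "\<And>n x. n0 \<le> n \<Longrightarrow> F (Suc n) x \<le> G (Suc n) x \<or>
      (G n (x - 1) \<le> G n x \<and> G n x \<le> G n (x - 1) + \<delta> \<and> G n x \<le> G n (x + 1) \<and>
       G n (x + 1) \<le> G n x + \<delta> \<and> acm_step m q r (G n) x \<le> G (Suc n) x)"
    and n: "n0 \<le> n"
  shows "F n x \<le> G n x"
  using n
proof (induction n arbitrary: x rule: dec_induct)
  case base
  show ?case by (rule init)
next
  case (step n)
  have "acm_step m q r (F n) x \<le> acm_step m q r (G n) x"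
    if G: "G n (x - 1) \<le> G n x" "G n x \<le> G n (x - 1) + \<delta>" "G n x \<le> G n (x + 1)"
       "G n (x + 1) \<le> G n x + \<delta>"
  proof (rule acm_step_mono)
    have "q * (F n x - F n (x - 1) + (G n x - G n (x - 1))) ^ m
        \<le> q * (F n x - F n (x - 1) + \<delta>) ^ m"
      using q G F_monoD[of "x - 1" x n] by (intro mult_left_mono power_mono) auto
    then show "q * (F n x - F n (x - 1) + (G n x - G n (x - 1))) ^ m \<le> 1"
      using headroom[OF step.hyps(1), of x] by linarith
    have "q * (F n (x + 1) - F n x + (G n (x + 1) - G n x)) ^ m
        \<le> q * (F n (x + 1) - F n x + \<delta>) ^ m"
      using q G F_monoD[of x "x + 1" n] by (intro mult_left_mono power_mono) auto
    then show "q * (F n (x + 1) - F n x + (G n (x + 1) - G n x)) ^ m \<le> 1"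
      using headroom[OF step.hyps(1), of "x + 1"] by simp
  qed (use m q r step.IH G F_monoD in auto)
  then show ?case using super[OF step.hyps(1), of x] by (auto simp: F_Suc intro: order_trans)
qed

lemma subsolution_le_F:
  assumes headroom: "\<And>n x. n0 \<le> n \<Longrightarrow> q * (F n x - F n (x - 1) + \<delta>) ^ m \<le> 1"
    and init: "\<And>x. G n0 x \<le> F n0 x"
    and G: "\<And>n x. n0 \<le> n \<Longrightarrow> G n (x - 1) \<le> G n x" "\<And>n x. n0 \<le> n \<Longrightarrow> G n x \<le> G n (x - 1) + \<delta>"
    and sub: "\<And>n x. n0 \<le> n \<Longrightarrow> G (Suc n) x \<le> acm_step m q r (G n) x"
    and n: "n0 \<le> n"
  shows "G n x \<le> F n x"
  using n
proof (induction n arbitrary: x rule: dec_induct)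
  case base
  show ?case by (rule init)
next
  case (step n)
  note G = G[OF step.hyps(1)]
  have bound: "q * (G n x - G n (x - 1) + (F n x - F n (x - 1))) ^ m \<le> 1" for x
  proof -
    have "q * (G n x - G n (x - 1) + (F n x - F n (x - 1))) ^ m
        \<le> q * (F n x - F n (x - 1) + \<delta>) ^ m"
      using q G[of x] F_monoD[of "x - 1" x n] by (intro mult_left_mono power_mono) auto
    then show ?thesis using headroom[OF step.hyps(1), of x] by linarith
  qed
  have "acm_step m q r (G n) x \<le> acm_step m q r (F n) x"
    by (rule acm_step_mono)
      (use m q r step.IH G(1)[of x] G(1)[of "x + 1"] F_monoD bound[of x] bound[of "x + 1"] in auto)
  then show ?case using sub[OF step.hyps(1), of x] by (simp add: F_Suc)
qed

section \<open>The upper barrier\<close>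

text \<open>
  The barrier \<open>\<epsilon>/2 + \<kappa>^(x - x1)\<close> has increments in geometric progression. It is a stationary
  supersolution as long as \<open>(1 - r) \<kappa>^(m+1) \<le> r\<close>, since then the flux to the right dominates; such
  \<open>\<kappa> > 1\<close> exist because of the drift.
\<close>

lemma left_tail_uniform:
  assumes headroom: "0 < \<delta>" "\<And>n x. n0 \<le> n \<Longrightarrow> q * (F n x - F n (x - 1) + \<delta>) ^ m \<le> 1"
    and "0 < \<epsilon>"
  shows "\<exists>x0. \<forall>n\<ge>n0. \<forall>x\<le>x0. F n x \<le> \<epsilon>"
proof -
  have "((\<lambda>\<kappa>. (1 - r) * \<kappa> ^ (m + 1)) \<longlongrightarrow> (1 - r) * 1 ^ (m + 1)) (at_right 1)"
    by (intro tendsto_intros)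
  then have "\<forall>\<^sub>F \<kappa> in at_right 1. (1 - r) * \<kappa> ^ (m + 1) < r"
    using r by (intro order_tendstoD) auto
  moreover have "\<forall>\<^sub>F \<kappa> in at_right 1. \<kappa> < 1 + \<delta>"
    using headroom(1) by (intro order_tendstoD[OF tendsto_ident_at]) auto
  ultimately have "\<forall>\<^sub>F \<kappa> in at_right 1. (1 - r) * \<kappa> ^ (m + 1) < r \<and> \<kappa> < 1 + \<delta> \<and> 1 < \<kappa>"
    using eventually_at_right_less by eventually_elim auto
  then obtain \<kappa> :: real where \<kappa>: "(1 - r) * \<kappa> ^ (m + 1) < r" "\<kappa> < 1 + \<delta>" "1 < \<kappa>"
    using eventually_happens' trivial_limit_at_right_real by blast
  have "\<forall>\<^sub>F x in at_bot. F n0 x < \<epsilon> / 2"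
    using F_bot \<open>0 < \<epsilon>\<close> by (intro order_tendstoD) auto
  then obtain x1 where x1: "\<And>x. x \<le> x1 \<Longrightarrow> F n0 x < \<epsilon> / 2"
    by (auto simp: eventually_at_bot_linorder)
  define u where "u x = \<kappa> powr real_of_int (x - x1)" for x
  have u_pos: "u x > 0" for x using \<kappa> by (simp add: u_def)
  have u_Suc: "u (x + 1) = \<kappa> * u x" "u (x - 1) = u x / \<kappa>" for x
    using \<kappa> by (simp_all add: u_def powr_add powr_diff)
  have bound: "F n x \<le> \<epsilon> / 2 + u x" if "n0 \<le> n" for n x
  proof (rule F_le_supersolution[where G = "\<lambda>_ x. \<epsilon> / 2 + u x", OF headroom(2) _ _ that])
    show "F n0 x \<le> \<epsilon> / 2 + u x" for x
    proof (cases "x \<le> x1")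
      case True
      then show ?thesis using x1[of x] u_pos[of x] by linarith
    next
      case False
      then have "1 \<le> u x" using \<kappa> by (auto simp: u_def intro!: ge_one_powr_ge_zero)
      then show ?thesis using F_le_1[of n0 x] \<open>0 < \<epsilon>\<close> by linarith
    qed
    fix n x
    define w where "w = u x - u x / \<kappa>"
    have \<kappa>w: "\<kappa> * u x - u x = \<kappa> * w" using \<kappa> by (simp add: w_def field_simps)
    have w: "0 \<le> w" using \<kappa> u_pos[of x] by (simp add: w_def field_simps)
    have w_le: "w \<le> \<kappa> * w" using mult_right_mono[of 1 \<kappa> w] \<kappa> w by simp
    have "F (Suc n) x \<le> \<epsilon> / 2 + u x" if "1 \<le> u x"
      using that F_le_1[of "Suc n" x] \<open>0 < \<epsilon>\<close> by linarith
    moreover have "\<kappa> * w \<le> \<delta>" if "u x \<le> 1"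
    proof -
      have "u x * (\<kappa> - 1) \<le> 1 * (\<kappa> - 1)" using that \<kappa> by (intro mult_right_mono) auto
      then show ?thesis using \<kappa> \<kappa>w by (simp add: algebra_simps)
    qed
    moreover have "acm_step m q r (\<lambda>x. \<epsilon> / 2 + u x) x \<le> \<epsilon> / 2 + u x"
    proof -
      have "((1 - r) * \<kappa> ^ (m + 1)) * (q * w ^ (m + 1)) \<le> r * (q * w ^ (m + 1))"
        using \<kappa> q w by (intro mult_right_mono) auto
      moreover have "acm_step m q r (\<lambda>x. \<epsilon> / 2 + u x) x
          = \<epsilon> / 2 + u x - r * q * w ^ (m + 1) + (1 - r) * q * (\<kappa> * w) ^ (m + 1)"
        by (simp only: acm_step_def u_Suc add_diff_cancel_left \<kappa>w flip: w_def)
      ultimately show ?thesis by (simp only: power_mult_distrib mult_ac)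
    qed
    ultimately show "F (Suc n) x \<le> \<epsilon> / 2 + u x \<or>
      (\<epsilon> / 2 + u (x - 1) \<le> \<epsilon> / 2 + u x \<and> \<epsilon> / 2 + u x \<le> \<epsilon> / 2 + u (x - 1) + \<delta> \<and>
       \<epsilon> / 2 + u x \<le> \<epsilon> / 2 + u (x + 1) \<and> \<epsilon> / 2 + u (x + 1) \<le> \<epsilon> / 2 + u x + \<delta> \<and>
       acm_step m q r (\<lambda>x. \<epsilon> / 2 + u x) x \<le> \<epsilon> / 2 + u x)"
      using w w_le \<kappa>w unfolding u_Suc w_def by linarith
  qed
  \<comment> \<open>To the left of this site the geometric term is at most \<open>\<epsilon> / 2\<close>.\<close>
  define x0 where "x0 = x1 + \<lfloor>log \<kappa> (\<epsilon> / 2)\<rfloor>"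
  have "F n x \<le> \<epsilon>" if "n0 \<le> n" "x \<le> x0" for n x
  proof -
    have "u x \<le> \<kappa> powr log \<kappa> (\<epsilon> / 2)"
      unfolding u_def using that \<kappa> by (intro powr_mono) (auto simp: x0_def, linarith)
    then have "u x \<le> \<epsilon> / 2" using \<kappa> \<open>0 < \<epsilon>\<close> by simp
    then show ?thesis using bound[OF that(1), of x] by simp
  qed
  then show ?thesis by auto
qed

text \<open>
  The hypothesis on \<open>c\<close> says \<open>c > C^\<theta>\<close> for the constant \<open>C\<close> of the limit profile, see
  \<open>profile_constant\<close>. The shift \<open>K\<close> places the left end of the barrier where \<open>F \<le> \<epsilon>\<close> for all times, at
  a large value of the profile variable \<open>x + K\<close>.
\<close>

lemma F_le_power_profile:
  assumes "0 < \<epsilon>" and c: "0 < c" "real m * \<theta> ^ (m + 1) * c ^ m * \<sigma> > 1"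
  obtains n0 t0 x0 K where "\<And>n x. n0 \<le> n \<Longrightarrow> x0 \<le> x \<Longrightarrow>
    F n x \<le> \<epsilon> + c * (real n - real n0 + t0) powr (- 1 / real m) * (real_of_int x + K) powr \<theta>"
proof -
  obtain n0 \<delta> where headroom: "0 < \<delta>" "\<And>n x. n0 \<le> n \<Longrightarrow> q * (F n x - F n (x - 1) + \<delta>) ^ m \<le> 1"
    using eventual_headroom by blast
  obtain x0 where x0: "\<And>n x. n0 \<le> n \<Longrightarrow> x \<le> x0 \<Longrightarrow> F n x \<le> \<epsilon>"
    using left_tail_uniform[OF headroom \<open>0 < \<epsilon>\<close>] by blast
  have \<theta>: "\<theta> > 0" using m by (simp add: \<theta>_def)
  define B where "B = real m * \<theta> ^ (m + 1) * c ^ m"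
  have "B > 0" using m \<theta> c by (simp add: B_def)
  have B: "B * (r * q - (1 - r) * q) > 1" using c by (simp add: B_def sigma_eq)
  have "\<forall>\<^sub>F X in at_top. X powr \<theta> \<le> B * (r * q * (X - 1) powr \<theta> - (1 - r) * q * (X + 1) powr \<theta>)"
    by (rule eventually_power_profile_large) fact+
  moreover have "\<forall>\<^sub>F X in at_top. 4 * \<theta> / X < \<delta>"
    using headroom(1) by (intro order_tendstoD) real_asymp
  moreover have "\<forall>\<^sub>F X in at_top. c * X powr \<theta> \<ge> 1"
  proof -
    have "filterlim (\<lambda>X. c * X powr \<theta>) at_top at_top"
      using c \<theta> by real_asymp
    then show ?thesis by (simp add: filterlim_at_top)
  qed
  ultimately have "\<forall>\<^sub>F X in at_top. X > 1 \<and> 4 * \<theta> / X < \<delta> \<and> c * X powr \<theta> \<ge> 1 \<and>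
      X powr \<theta> \<le> B * (r * q * (X - 1) powr \<theta> - (1 - r) * q * (X + 1) powr \<theta>)"
    using eventually_gt_at_top[of 1] by eventually_elim auto
  then obtain X0 where X0: "\<And>X. X \<ge> X0 \<Longrightarrow> X > 1 \<and> 4 * \<theta> / X < \<delta> \<and> c * X powr \<theta> \<ge> 1 \<and>
      X powr \<theta> \<le> B * (r * q * (X - 1) powr \<theta> - (1 - r) * q * (X + 1) powr \<theta>)"
    unfolding eventually_at_top_linorder by blast
  \<comment> \<open>With this starting time the barrier exceeds 1 from the site \<open>x0\<close> on, so it dominates \<open>F n0\<close>.\<close>
  define t0 where "t0 = (c * X0 powr \<theta>) ^ m"
  have t0: "t0 \<ge> 1" using X0[of X0] by (simp add: t0_def one_le_power)
  have y: "c * X0 powr \<theta> > 0" using c X0[of X0] by simp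
  have "t0 powr (1 / real m) = ((c * X0 powr \<theta>) powr real m) powr (1 / real m)"
    unfolding t0_def powr_realpow[OF y] ..
  also have "\<dots> = (c * X0 powr \<theta>) powr (real m * (1 / real m))" by (rule powr_powr)
  also have "\<dots> = c * X0 powr \<theta>" using m y by simp
  finally have front0: "c * t0 powr (- 1 / real m) * X0 powr \<theta> = 1"
    using c X0[of X0] by (simp add: powr_minus field_simps)
  define K where "K = X0 - real_of_int x0"
  define g where "g t X = c * t powr (- 1 / real m) * X powr \<theta>" for t X
  define G where "G n x = \<epsilon> + g (real n - real n0 + t0) (real_of_int x + K)" for n x
  have g_nonneg: "g t X \<ge> 0" for t X using c by (simp add: g_def)
  have "F n x \<le> G n x" if "n0 \<le> n" for n x
  proof (rule F_le_supersolution[OF headroom(2) _ _ that])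
    show "F n0 x \<le> G n0 x" for x
    proof (cases "x \<le> x0")
      case True
      then show ?thesis using x0[of n0 x] g_nonneg[of t0 "real_of_int x + K"] by (simp add: G_def)
    next
      case False
      have "g t0 X0 \<le> g t0 (real_of_int x + K)"
        unfolding g_def using c \<theta> False X0[of X0] by (intro mult_left_mono powr_mono2) (auto simp: K_def)
      then show ?thesis using front0 F_le_1[of n0 x] \<open>0 < \<epsilon>\<close> by (simp add: G_def g_def)
    qed
    fix n x assume n: "n0 \<le> n"
    define t X where "t = real n - real n0 + t0" and "X = real_of_int x + K"
    have t: "t \<ge> 1" "t > 0" using n t0 by (auto simp: t_def)
    have G: "G n x = \<epsilon> + g t X" "G n (x + 1) = \<epsilon> + g t (X + 1)" "G n (x - 1) = \<epsilon> + g t (X - 1)"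
      "G (Suc n) x = \<epsilon> + g (t + 1) X"
      by (simp_all add: G_def t_def X_def algebra_simps)
    consider "x \<le> x0" | "1 \<le> g (t + 1) X" | "x0 < x" "g (t + 1) X \<le> 1" by linarith
    then show "F (Suc n) x \<le> G (Suc n) x \<or>
      (G n (x - 1) \<le> G n x \<and> G n x \<le> G n (x - 1) + \<delta> \<and> G n x \<le> G n (x + 1) \<and>
       G n (x + 1) \<le> G n x + \<delta> \<and> acm_step m q r (G n) x \<le> G (Suc n) x)"
    proof cases
      case 1
      then show ?thesis using x0[of "Suc n" x] n g_nonneg[of "t + 1" X] by (simp add: G)
    next
      case 2
      then show ?thesis using F_le_1[of "Suc n" x] \<open>0 < \<epsilon>\<close> by (simp add: G)
    next
      case 3
      then have "X \<ge> X0" by (simp add: X_def K_def)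
      note X = X0[OF this]
      have mono: "g t (X - 1) \<le> g t X" "g t X \<le> g t (X + 1)"
        unfolding g_def using c \<theta> X by (auto intro!: mult_left_mono powr_mono2)
      have incr: "g t X - g t (X - 1) \<le> 4 * \<theta> / X" "g t (X + 1) - g t X \<le> 4 * \<theta> / X"
        using power_profile_increments[OF m _ t(1) c(1), of X] X 3 unfolding g_def \<theta>_def by auto
      have "g t X - r * q * (g t X - g t (X - 1)) ^ (m + 1) + (1 - r) * q * (g t (X + 1) - g t X) ^ (m + 1)
          \<le> g (t + 1) X"
        unfolding g_def \<theta>_def
        by (rule power_profile_supersolution) (use m X t c q r in \<open>auto simp: B_def \<theta>_def\<close>)
      then have "acm_step m q r (G n) x \<le> G (Suc n) x"
        by (simp only: acm_step_def G add_diff_cancel_left)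
      then show ?thesis using mono incr X unfolding G by linarith
    qed
  qed
  then show thesis using that[of n0 x0 t0 K] by (simp add: G_def g_def)
qed

section \<open>The lower barrier\<close>

text \<open>
  At time \<open>n0\<close> the wave is at most \<open>b \<le> F n0\<close> to the right of \<open>K\<close> and at most \<open>0\<close> to its left; the
  comparison principle propagates this.
\<close>

lemma softmin_wave_le_F:
  assumes "\<And>n x. n0 \<le> n \<Longrightarrow> q * (F n x - F n (x - 1) + \<delta>) ^ m \<le> 1"
    and K: "\<And>x. K \<le> x \<Longrightarrow> b \<le> F n0 x"
    and pos: "0 < \<kappa>" "0 < w" "w \<le> \<delta>" "0 \<le> v"
    and v: "r * q * exp (\<kappa> * w) ^ (m + 1) - (1 - r) * q / exp (\<kappa> * w) ^ (m + 1) \<le> v"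
    and n: "n0 \<le> n"
  shows "softmin \<kappa> b (w * real_of_int (x - K) - v * w ^ (m + 1) * (real n - real n0)) \<le> F n x"
proof (rule subsolution_le_F[where \<delta> = \<delta> and ?n0.0 = n0])
  let ?\<xi> = "\<lambda>n x. w * real_of_int (x - K) - v * w ^ (m + 1) * (real n - real n0)"
  have shift: "?\<xi> n (x + 1) = ?\<xi> n x + w" "?\<xi> n (x - 1) = ?\<xi> n x - w"
    "?\<xi> (Suc n) x = ?\<xi> n x - v * w ^ (m + 1)" for n x
    by (simp_all add: algebra_simps)
  fix x
  show "softmin \<kappa> b (?\<xi> n0 x) \<le> F n0 x"
  proof (cases "K \<le> x")
    case True
    then show ?thesis using K[of x] softmin_le(1)[OF pos(1), of b "?\<xi> n0 x"] by linarith
  next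
    case False
    then have "?\<xi> n0 x \<le> 0" using pos by (auto simp: mult_le_0_iff)
    then show ?thesis using softmin_le(2)[OF pos(1), of b "?\<xi> n0 x"] F_nonneg[of n0 x] by linarith
  qed
  fix n
  show "softmin \<kappa> b (?\<xi> n (x - 1)) \<le> softmin \<kappa> b (?\<xi> n x)"
    "softmin \<kappa> b (?\<xi> n x) \<le> softmin \<kappa> b (?\<xi> n (x - 1)) + \<delta>"
    using softmin_increment[of \<kappa> w b "?\<xi> n x - w"] pos unfolding shift(2)[of x n] by auto
  show "softmin \<kappa> b (?\<xi> (Suc n) x) \<le> acm_step m q r (\<lambda>x. softmin \<kappa> b (?\<xi> n x)) x"
    unfolding acm_step_def shift
    by (rule softmin_wave_subsolution) (use pos v q r in auto)
qed (use assms in auto)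

section \<open>The scaling limit of the distribution functions\<close>

text \<open>
  The constant \<open>C\<close> of the theorem: the front of the limit profile is at \<open>n^(1/(m+1)) / scale\<close>.
\<close>

definition scale :: real where
  "scale = 1 / (real m + 1) * (real m ^ m / \<sigma>) powr (1 / (real m + 1))"

lemma scale_pos: "scale > 0"
  using m sigma_pos by (simp add: scale_def)

lemma scale_power: "scale ^ (m + 1) = real m ^ m / ((real m + 1) ^ (m + 1) * \<sigma>)"
proof -
  have y: "real m ^ m / \<sigma> > 0" using m sigma_pos by simp
  have "((real m ^ m / \<sigma>) powr (1 / (real m + 1))) ^ (m + 1)
      = (real m ^ m / \<sigma>) powr (real (m + 1) * (1 / (real m + 1)))"
    using y by (intro powr_power) auto
  also have "real (m + 1) * (1 / (real m + 1)) = 1" by (simp add: divide_simps)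
  also have "(real m ^ m / \<sigma>) powr 1 = real m ^ m / \<sigma>" using y by (intro powr_one) linarith
  finally show ?thesis
    by (simp only: scale_def power_mult_distrib power_one_over) simp
qed

lemma power_of_scale_powr: "((scale * y) powr \<theta>) ^ m = (scale * y) ^ (m + 1)" if "y > 0"
proof -
  have "scale * y > 0" using that scale_pos by simp
  moreover have "real m * \<theta> = real (m + 1)" using m by (simp add: \<theta>_def)
  ultimately have "((scale * y) powr \<theta>) ^ m = (scale * y) powr real (m + 1)"
    using m by (subst powr_power) auto
  then show ?thesis using \<open>scale * y > 0\<close> by (simp only: powr_realpow)
qed

text \<open>
  \<open>c = scale powr \<theta>\<close> is the coefficient for which \<open>c t^(-1/m) x^\<theta>\<close> solves
  \<open>F\<^sub>t + \<sigma> (F\<^sub>x)^(m+1) = 0\<close> exactly.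
\<close>

lemma profile_constant: "real m * \<theta> ^ (m + 1) * (scale powr \<theta>) ^ m * \<sigma> = 1"
proof -
  have "(scale powr \<theta>) ^ m = real m ^ m / ((real m + 1) ^ (m + 1) * \<sigma>)"
    using power_of_scale_powr[of 1] by (simp only: mult_1_right zero_less_one scale_power)
  then show ?thesis
    using m sigma_pos by (simp add: \<theta>_def power_divide divide_simps mult_ac)
qed

lemma time_scale_power: "(real n powr (1 / (real m + 1))) ^ (m + 1) = real n" if "n > 0"
proof -
  have "(real n powr (1 / (real m + 1))) ^ (m + 1) = real n powr (real (m + 1) * (1 / (real m + 1)))"
    using that by (intro powr_power) auto
  also have "real (m + 1) * (1 / (real m + 1)) = 1" by (simp add: divide_simps)
  also have "real n powr 1 = real n" using that by simp
  finally show ?thesis .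
qed

lemma time_scale_at_top: "filterlim (\<lambda>n. real n powr (1 / (real m + 1))) at_top sequentially"
  by (rule filterlim_compose[OF real_powr_at_top filterlim_real_sequentially]) simp

lemma F_eventually_less:
  assumes y: "y > 0" and a: "(scale * y) powr \<theta> < a"
  shows "\<forall>\<^sub>F n in sequentially. F n \<lfloor>y * real n powr (1 / (real m + 1))\<rfloor> < a"
proof -
  define s where "s n = real n powr (1 / (real m + 1))" for n :: nat
  \<comment> \<open>A third of the gap \<open>d\<close> pays for \<open>\<epsilon>\<close>, a third for \<open>c\<close>, and a third remains for the limit.\<close>
  define d where "d = a - (scale * y) powr \<theta>"
  define c where "c = scale powr \<theta> + d / (3 * y powr \<theta>)"
  have d: "d > 0" using a by (simp add: d_def)
  have c_y: "c * y powr \<theta> = a - 2 * d / 3"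
    using y scale_pos by (simp add: c_def d_def powr_mult field_simps)
  have c_gt: "c > scale powr \<theta>" using d y by (simp add: c_def)
  then have c: "c > 0" using powr_ge_zero[of scale \<theta>] by linarith
  have \<theta>: "\<theta> > 0" using m by (simp add: \<theta>_def)
  have "(scale powr \<theta>) ^ m < c ^ m" using c_gt m by (intro power_strict_mono) auto
  then have "real m * \<theta> ^ (m + 1) * (scale powr \<theta>) ^ m * \<sigma> < real m * \<theta> ^ (m + 1) * c ^ m * \<sigma>"
    using m \<theta> sigma_pos by (intro mult_strict_right_mono mult_strict_left_mono) auto
  then have "real m * \<theta> ^ (m + 1) * c ^ m * \<sigma> > 1" by (simp only: profile_constant)
  then obtain n0 t0 x0 K where bound: "\<And>n x. n0 \<le> n \<Longrightarrow> x0 \<le> x \<Longrightarrow>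
      F n x \<le> d / 3 + c * (real n - real n0 + t0) powr (- 1 / real m) * (real_of_int x + K) powr \<theta>"
    using F_le_power_profile[of "d / 3" c] d c by (metis divide_pos_pos zero_less_numeral)
  have time: "((\<lambda>n. (real n - real n0 + t0) / real n) \<longlongrightarrow> 1) sequentially"
    by real_asymp
  have shift: "((\<lambda>n. K / s n) \<longlongrightarrow> 0) sequentially"
    unfolding s_def by (intro tendsto_intros tendsto_divide_0[OF tendsto_const]
        filterlim_mono[OF time_scale_at_top at_top_le_at_infinity order_refl])
  have "((\<lambda>n. d / 3 + c * ((real n - real n0 + t0) / real n) powr (- 1 / real m) * (y + K / s n) powr \<theta>)
      \<longlongrightarrow> d / 3 + c * 1 powr (- 1 / real m) * (y + 0) powr \<theta>) sequentially"
    using y by (intro tendsto_intros time shift) auto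
  moreover have "d / 3 + c * 1 powr (- 1 / real m) * (y + 0) powr \<theta> < a"
    using c_y d by simp
  ultimately have "\<forall>\<^sub>F n in sequentially. d / 3 + c * ((real n - real n0 + t0) / real n) powr (- 1 / real m)
      * (y + K / s n) powr \<theta> < a"
    by (rule order_tendstoD)
  moreover have "filterlim (\<lambda>n. y * s n) at_top sequentially"
    unfolding s_def using y by (intro filterlim_tendsto_pos_mult_at_top[OF tendsto_const _ time_scale_at_top])
  then have "\<forall>\<^sub>F n in sequentially. y * s n \<ge> max (real_of_int x0) (1 - K)"
    unfolding filterlim_at_top by blast
  moreover have "\<forall>\<^sub>F n in sequentially. real n > real n0 + \<bar>t0\<bar>" by real_asymp
  ultimately show ?thesis
    using eventually_ge_at_top[of n0] eventually_gt_at_top[of 0]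
  proof eventually_elim
    case (elim n)
    define x where "x = \<lfloor>y * s n\<rfloor>"
    have s: "s n > 0" using elim by (simp add: s_def)
    have x: "x0 \<le> x" "real_of_int x \<le> y * s n" "0 \<le> real_of_int x + K"
      using elim(2) unfolding x_def by (auto simp: le_floor_iff) linarith
    have "s n powr \<theta> = real n powr (1 / real m)"
      using m by (simp add: s_def \<theta>_def powr_powr)
    moreover have "y + K / s n = (y * s n + K) / s n" using s by (simp add: field_simps)
    ultimately have "(y + K / s n) powr \<theta> = (y * s n + K) powr \<theta> / real n powr (1 / real m)"
      using s x by (simp add: powr_divide)
    moreover have "((real n - real n0 + t0) / real n) powr (- 1 / real m)
        = (real n - real n0 + t0) powr (- 1 / real m) * real n powr (1 / real m)"
      using elim by (simp add: powr_divide powr_minus field_simps)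
    ultimately have eq: "((real n - real n0 + t0) / real n) powr (- 1 / real m) * (y + K / s n) powr \<theta>
        = (real n - real n0 + t0) powr (- 1 / real m) * (y * s n + K) powr \<theta>"
      using elim by simp
    have "F n x \<le> d / 3 + c * (real n - real n0 + t0) powr (- 1 / real m) * (real_of_int x + K) powr \<theta>"
      using bound elim x by blast
    also have "\<dots> \<le> d / 3 + c * (real n - real n0 + t0) powr (- 1 / real m) * (y * s n + K) powr \<theta>"
      using c \<theta> x by (intro add_mono mult_left_mono powr_mono2) auto
    also have "\<dots> < a" using elim(1) eq by (simp only: mult.assoc)
    finally show ?case by (simp add: x_def s_def)
  qed
qed

text \<open>
  The slope \<open>w\<close> of the wave is tuned to the final time \<open>n\<close>: \<open>w = l / n^(1/(m+1))\<close>, with \<open>l\<close> the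
  maximiser in the Legendre transform, so each \<open>n\<close> uses a wave of its own.
\<close>

lemma F_eventually_greater:
  assumes y: "y > 0" and a: "a < min 1 ((scale * y) powr \<theta>)"
  shows "\<forall>\<^sub>F n in sequentially. a < F n \<lfloor>y * real n powr (1 / (real m + 1))\<rfloor>"
proof -
  define s where "s n = real n powr (1 / (real m + 1))" for n :: nat
  obtain n0 \<delta> where headroom: "0 < \<delta>" "\<And>n x. n0 \<le> n \<Longrightarrow> q * (F n x - F n (x - 1) + \<delta>) ^ m \<le> 1"
    using eventual_headroom by blast
  \<comment> \<open>The maximiser of \<open>l y - \<sigma> l^(m+1)\<close>.\<close>
  define l where "l = (y / ((real m + 1) * \<sigma>)) powr (1 / real m)"
  have l: "l > 0" using y sigma_pos by (simp add: l_def add_nonneg_pos)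
  have l_pow: "l ^ m = y / ((real m + 1) * \<sigma>)"
  proof -
    have "l ^ m = (y / ((real m + 1) * \<sigma>)) powr (real m * (1 / real m))"
      unfolding l_def using m y sigma_pos by (intro powr_power) auto
    also have "\<dots> = y / ((real m + 1) * \<sigma>)"
      using m y sigma_pos by (simp add: add_nonneg_pos)
    finally show ?thesis .
  qed
  have "l * y - \<sigma> * l ^ (m + 1) = l * y * real m / (real m + 1)"
    using sigma_pos by (simp add: l_pow divide_simps) (simp add: algebra_simps)
  also have "\<dots> = (scale * y) powr \<theta>"
  proof (rule power_eq_imp_eq_base)
    show "(l * y * real m / (real m + 1)) ^ m = ((scale * y) powr \<theta>) ^ m"
      unfolding power_of_scale_powr[OF y] power_mult_distrib power_divide l_pow scale_power
      by (simp add: field_simps)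
  qed (use l y m in auto)
  finally have optimum: "l * y - \<sigma> * l ^ (m + 1) = (scale * y) powr \<theta>" .
  \<comment> \<open>Faster than \<open>\<sigma>\<close>, so that the wave is a strict subsolution, at the cost of half of the gap to \<open>a\<close>.\<close>
  define v where "v = \<sigma> + ((scale * y) powr \<theta> - a) / (2 * l ^ (m + 1))"
  have a_less: "a < (scale * y) powr \<theta>" using a by simp
  have v: "v > \<sigma>" using a l by (simp add: v_def)
  define \<xi> where "\<xi> = l * y - v * l ^ (m + 1)"
  have "v * l ^ (m + 1) = \<sigma> * l ^ (m + 1) + ((scale * y) powr \<theta> - a) / 2"
    using l by (simp add: v_def field_simps del: power_Suc)
  then have "\<xi> = (l * y - \<sigma> * l ^ (m + 1)) - ((scale * y) powr \<theta> - a) / 2"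
    by (simp only: \<xi>_def diff_diff_eq)
  then have "\<xi> = ((scale * y) powr \<theta> + a) / 2" unfolding optimum by (simp add: field_simps)
  then have \<xi>: "a < \<xi>" using a_less by simp
  obtain b where b: "a < b" "b < 1" using dense[of a 1] a by auto
  \<comment> \<open>Makes the defect \<open>ln 2 / \<kappa>\<close> of \<open>softmin\<close> against \<open>min\<close> half of the remaining gap.\<close>
  define \<kappa> where "\<kappa> = 2 * ln 2 / (min \<xi> b - a)"
  have \<kappa>: "\<kappa> > 0" using b \<xi> by (simp add: \<kappa>_def)
  have less_min: "a < min \<xi> b" using b \<xi> by simp
  have \<kappa>_eq: "ln 2 / \<kappa> = (min \<xi> b - a) / 2" using b \<xi> by (simp add: \<kappa>_def)
  have halfway: "a < z - (z - a) / 2" if "a < z" for z using that by (simp add: field_simps)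
  have target: "a < softmin \<kappa> b \<xi>"
    using halfway[OF less_min] softmin_ge[OF \<kappa>, of \<xi> b] unfolding \<kappa>_eq by (rule less_le_trans)
  have "\<forall>\<^sub>F x in at_top. b < F n0 x" using F_top b by (intro order_tendstoD) auto
  then obtain K where K: "\<And>x. K \<le> x \<Longrightarrow> b \<le> F n0 x"
    unfolding eventually_at_top_linorder by (meson less_imp_le)
  define w where "w n = l / s n" for n
  have w_0: "(w \<longlongrightarrow> 0) sequentially"
    unfolding w_def s_def by (intro tendsto_divide_0[OF tendsto_const]
        filterlim_mono[OF time_scale_at_top at_top_le_at_infinity order_refl])
  have "((\<lambda>n. r * q * exp (\<kappa> * w n) ^ (m + 1) - (1 - r) * q / exp (\<kappa> * w n) ^ (m + 1))
      \<longlongrightarrow> r * q * exp (\<kappa> * 0) ^ (m + 1) - (1 - r) * q / exp (\<kappa> * 0) ^ (m + 1)) sequentially"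
    by (intro tendsto_intros w_0) auto
  moreover have "r * q * exp (\<kappa> * 0) ^ (m + 1) - (1 - r) * q / exp (\<kappa> * 0) ^ (m + 1) < v"
    using v sigma_eq by simp
  ultimately have "\<forall>\<^sub>F n in sequentially.
      r * q * exp (\<kappa> * w n) ^ (m + 1) - (1 - r) * q / exp (\<kappa> * w n) ^ (m + 1) < v"
    by (rule order_tendstoD)
  moreover have "\<forall>\<^sub>F n in sequentially. w n < \<delta>"
    using w_0 headroom(1) by (intro order_tendstoD)
  moreover have "((\<lambda>n. softmin \<kappa> b (l * y - w n * (1 + real_of_int K) - v * l ^ (m + 1) * ((real n - real n0) / real n)))
      \<longlongrightarrow> softmin \<kappa> b \<xi>) sequentially"
  proof (rule isCont_tendsto_compose[OF isCont_softmin])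
    have "((\<lambda>n. (real n - real n0) / real n) \<longlongrightarrow> 1) sequentially" by real_asymp
    then have "((\<lambda>n. l * y - w n * (1 + real_of_int K) - v * l ^ (m + 1) * ((real n - real n0) / real n))
        \<longlongrightarrow> l * y - 0 * (1 + real_of_int K) - v * l ^ (m + 1) * 1) sequentially"
      by (intro tendsto_intros w_0)
    then show "((\<lambda>n. l * y - w n * (1 + real_of_int K) - v * l ^ (m + 1) * ((real n - real n0) / real n))
        \<longlongrightarrow> \<xi>) sequentially" by (simp add: \<xi>_def)
  qed
  then have "\<forall>\<^sub>F n in sequentially. a < softmin \<kappa> b
      (l * y - w n * (1 + real_of_int K) - v * l ^ (m + 1) * ((real n - real n0) / real n))"
    using target by (rule order_tendstoD)
  ultimately show ?thesis
    using eventually_ge_at_top[of n0] eventually_gt_at_top[of 0]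
  proof eventually_elim
    case (elim n)
    define x where "x = \<lfloor>y * s n\<rfloor>"
    have s: "s n > 0" using elim by (simp add: s_def)
    have w: "w n > 0" using s l by (simp add: w_def)
    have w_pow: "w n ^ (m + 1) = l ^ (m + 1) / real n"
      using time_scale_power[of n] elim by (simp only: w_def s_def power_divide)
    have "y * s n - 1 \<le> real_of_int x" unfolding x_def by linarith
    then have "w n * (y * s n - 1) \<le> w n * real_of_int x"
      using w by (intro mult_left_mono) auto
    moreover have "w n * (y * s n - 1) = l * y - w n"
      using s by (simp add: w_def field_simps)
    ultimately have "l * y - w n \<le> w n * real_of_int x" by (simp only:)
    then have "l * y - w n * (1 + real_of_int K) - v * l ^ (m + 1) * ((real n - real n0) / real n)
        \<le> w n * real_of_int (x - K) - v * w n ^ (m + 1) * (real n - real n0)"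
      unfolding w_pow by (simp add: algebra_simps)
    then obtain h where h: "h \<ge> 0" "w n * real_of_int (x - K) - v * w n ^ (m + 1) * (real n - real n0)
        = l * y - w n * (1 + real_of_int K) - v * l ^ (m + 1) * ((real n - real n0) / real n) + h"
      by (metis add.commute diff_add_cancel diff_ge_0_iff_ge)
    have "a < softmin \<kappa> b (w n * real_of_int (x - K) - v * w n ^ (m + 1) * (real n - real n0))"
      unfolding h(2) using elim(3) softmin_increment(1)[OF \<kappa> h(1)] by (rule less_le_trans)
    also have "\<dots> \<le> F n x"
      by (rule softmin_wave_le_F[OF headroom(2) K]) (use \<kappa> w elim v sigma_pos in auto)
    finally show ?case by (simp add: x_def s_def)
  qed
qed

lemma F_rescaled_tendsto_beta1:
  "(\<lambda>n. F n \<lfloor>z / scale * real n powr (1 / (real m + 1))\<rfloor>) \<longlonglongrightarrow> beta1_cdf \<theta> z"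
proof (rule order_tendstoI)
  define y where "y = z / scale"
  have z: "z = scale * y" and y_pos: "y > 0 \<longleftrightarrow> z > 0" using scale_pos by (auto simp: y_def zero_less_divide_iff)
  have \<theta>: "\<theta> > 0" using m by (simp add: \<theta>_def)
  fix a
  {
    assume a: "a < beta1_cdf \<theta> z"
    show "\<forall>\<^sub>F n in sequentially. a < F n \<lfloor>z / scale * real n powr (1 / (real m + 1))\<rfloor>"
    proof (cases "z > 0")
      case True
      then have "beta1_cdf \<theta> z \<le> min 1 (z powr \<theta>)"
        using \<theta> by (auto simp: beta1_cdf_def powr_le1 ge_one_powr_ge_zero)
      then show ?thesis
        using a True y_pos F_eventually_greater[of y a] by (simp flip: z y_def)
    next
      case False
      then have "a < 0" using a by (simp add: beta1_cdf_def)
      then show ?thesis using F_nonneg by (intro always_eventually allI) (rule less_le_trans)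
    qed
  next
    assume a: "beta1_cdf \<theta> z < a"
    consider "z \<le> 0" | "0 < z" "z \<le> 1" | "1 < z" by linarith
    then show "\<forall>\<^sub>F n in sequentially. F n \<lfloor>z / scale * real n powr (1 / (real m + 1))\<rfloor> < a"
    proof cases
      case 1
      then have "a > 0" using a by (simp add: beta1_cdf_def)
      \<comment> \<open>A positive point where the power in the limit is still only \<open>a / 2\<close>.\<close>
      define y' where "y' = (a / 2) powr (1 / \<theta>) / scale"
      have "y' > 0" using \<open>a > 0\<close> scale_pos by (simp add: y'_def)
      moreover have "y \<le> 0" using 1 scale_pos by (simp add: y_def divide_nonpos_pos)
      ultimately have y': "y' > 0" "y \<le> y'" by auto
      have "(scale * y') powr \<theta> = a / 2"
        using scale_pos \<theta> \<open>a > 0\<close> by (simp add: y'_def powr_powr)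
      then have "\<forall>\<^sub>F n in sequentially. F n \<lfloor>y' * real n powr (1 / (real m + 1))\<rfloor> < a"
        using y' \<open>a > 0\<close> by (intro F_eventually_less) auto
      then show ?thesis
      proof eventually_elim
        case (elim n)
        have "F n \<lfloor>y * real n powr (1 / (real m + 1))\<rfloor> \<le> F n \<lfloor>y' * real n powr (1 / (real m + 1))\<rfloor>"
          using y' by (intro F_monoD floor_mono mult_right_mono) auto
        then show ?case using elim by (simp add: y_def)
      qed
    next
      case 2
      then show ?thesis
        using a y_pos F_eventually_less[of y a] by (simp add: beta1_cdf_def flip: z y_def)
    next
      case 3
      then have "1 < a" using a by (simp add: beta1_cdf_def)
      then show ?thesis using F_le_1 by (intro always_eventually allI) (rule le_less_trans)
    qed
  }
qed

end

section \<open>From the process to its distribution functions\<close>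

text \<open>
  Reflection \<open>x \<mapsto> - x\<close> of the position turns \<open>F\<close> into \<open>1 - F (- x - 1)\<close> and exchanges the two
  directions of motion.
\<close>

lemma acm_step_reflect:
  "acm_step m q (1 - r) (\<lambda>x. 1 - F (- x - 1)) x = 1 - acm_step m q r F (- x - 1)"
proof -
  have "- (x - 1) - 1 = - x - 1 + 1" "- (x + 1) - 1 = - x - 1 - 1" by simp_all
  then show ?thesis by (simp only: acm_step_def) (simp add: algebra_simps)
qed

context acm_realisation
begin

lemma measurable_position: "X n \<in> measurable N (count_space UNIV)"
  and measurable_displacement: "D n \<in> measurable N (count_space UNIV)"
proof -
  have *: "random_variable (count_space UNIV) (if j = 0 then X n else if j \<le> m then X' n j else D n)"
    if "j \<in> {0..m + 1}" for j
    using indep_step[of n] that unfolding indep_vars_def by blast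
  show "X n \<in> measurable N (count_space UNIV)" using *[of 0] by simp
  show "D n \<in> measurable N (count_space UNIV)" using *[of "m + 1"] by simp
qed

lemma sets_position [measurable]: "{\<omega> \<in> space N. P (X n \<omega>)} \<in> sets N"
  using measurable_sets[OF measurable_position[of n], of "{x. P x}"]
  by (simp add: vimage_def Int_def conj_commute)

lemma sets_displacement [measurable]: "{\<omega> \<in> space N. P (D n \<omega>)} \<in> sets N"
  using measurable_sets[OF measurable_displacement[of n], of "{x. P x}"]
  by (simp add: vimage_def Int_def conj_commute)

definition pos_cdf :: "nat \<Rightarrow> int \<Rightarrow> real" where
  "pos_cdf n x = prob {\<omega> \<in> space N. X n \<omega> \<le> x}"

definition move_event :: "nat \<Rightarrow> int \<Rightarrow> int \<Rightarrow> 'b set" where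
  "move_event n a d = {\<omega> \<in> space N. X n \<omega> = a \<and> (\<forall>i\<in>{1..m}. X' n i \<omega> = a) \<and> D n \<omega> = d}"

lemma prob_position: "prob {\<omega> \<in> space N. X n \<omega> = x} = pos_cdf n x - pos_cdf n (x - 1)"
proof -
  have "{\<omega> \<in> space N. X n \<omega> = x} = {\<omega> \<in> space N. X n \<omega> \<le> x} - {\<omega> \<in> space N. X n \<omega> \<le> x - 1}"
    by auto
  then show ?thesis by (simp add: pos_cdf_def finite_measure_Diff subset_eq)
qed

lemma prob_copy:
  assumes "i \<in> {1..m}"
  shows "prob (X' n i -` {a} \<inter> space N) = prob {\<omega> \<in> space N. X n \<omega> = a}"
proof -
  have "random_variable (count_space UNIV) (X' n i)"
    using indep_step[of n] assms unfolding indep_vars_def by (auto dest!: bspec[of _ _ i])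
  then have "prob (X' n i -` {a} \<inter> space N) = measure (distr N (count_space UNIV) (X' n i)) {a}"
    by (simp add: measure_distr)
  also have "\<dots> = prob (X n -` {a} \<inter> space N)"
    using measurable_position by (simp add: distr_copy[OF assms] measure_distr)
  finally show ?thesis by (simp add: vimage_def Int_def conj_commute)
qed

lemma move_event:
  shows sets_move_event [measurable]: "move_event n a d \<in> sets N"
    and prob_move_event: "prob (move_event n a d)
      = prob {\<omega> \<in> space N. X n \<omega> = a} ^ (m + 1) * prob {\<omega> \<in> space N. D n \<omega> = d}"
proof -
  define Z where "Z j = (if j = 0 then X n else if j \<le> m then X' n j else D n)" for j
  define A where "A j = (if j \<le> m then {a} else {d})" for j
  have indep: "indep_vars (\<lambda>_. count_space UNIV) Z {0..m + 1}"
    using indep_step[of n] by (simp add: Z_def[abs_def])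
  have move: "move_event n a d = (\<Inter>j\<in>{0..m + 1}. Z j -` A j \<inter> space N)"
  proof (intro set_eqI iffI)
    fix \<omega> assume "\<omega> \<in> (\<Inter>j\<in>{0..m + 1}. Z j -` A j \<inter> space N)"
    then have *: "Z j \<omega> \<in> A j" "\<omega> \<in> space N" if "j \<le> m + 1" for j using that by auto
    have "X n \<omega> = a" using *(1)[of 0] by (simp add: Z_def A_def)
    moreover have "D n \<omega> = d" using *(1)[of "m + 1"] by (simp add: Z_def A_def)
    moreover have "X' n i \<omega> = a" if "i \<in> {1..m}" for i
      using *(1)[of i] that by (simp add: Z_def A_def)
    ultimately show "\<omega> \<in> move_event n a d" using *(2)[of 0] by (simp add: move_event_def)
  qed (auto simp: move_event_def Z_def A_def)
  have Z_sets: "Z j -` A j \<inter> space N \<in> sets N" if "j \<in> {0..m + 1}" for j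
  proof (rule measurable_sets)
    show "Z j \<in> measurable N (count_space UNIV)"
      using indep that unfolding indep_vars_def by blast
  qed simp
  show "move_event n a d \<in> sets N"
    unfolding move by (rule sets.finite_INT[OF _ _ Z_sets]) simp_all
  have "prob (move_event n a d) = (\<Prod>j\<in>{0..m + 1}. prob (Z j -` A j \<inter> space N))"
    unfolding move by (intro indep_varsD[OF indep]) auto
  also have "{0..m + 1} = insert (m + 1) {0..m}" by auto
  also have "(\<Prod>j\<in>insert (m + 1) {0..m}. prob (Z j -` A j \<inter> space N))
      = prob (D n -` {d} \<inter> space N) * (\<Prod>j\<in>{0..m}. prob (Z j -` A j \<inter> space N))"
    by (simp add: Z_def A_def)
  also have "(\<Prod>j\<in>{0..m}. prob (Z j -` A j \<inter> space N))
      = (\<Prod>j\<in>{0..m}. prob {\<omega> \<in> space N. X n \<omega> = a})"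
  proof (intro prod.cong refl)
    fix j assume j: "j \<in> {0..m}"
    show "prob (Z j -` A j \<inter> space N) = prob {\<omega> \<in> space N. X n \<omega> = a}"
    proof (cases "j = 0")
      case True
      then show ?thesis by (simp add: Z_def A_def vimage_def Int_def conj_commute)
    next
      case False
      then show ?thesis using prob_copy[of j n a] j by (simp add: Z_def A_def)
    qed
  qed
  finally show "prob (move_event n a d)
      = prob {\<omega> \<in> space N. X n \<omega> = a} ^ (m + 1) * prob {\<omega> \<in> space N. D n \<omega> = d}"
    by (simp add: vimage_def Int_def conj_commute)
qed

lemma AE_displacement: "AE \<omega> in N. D n \<omega> \<in> {1, 0, -1}"
proof -
  let ?E = "\<lambda>d. {\<omega> \<in> space N. D n \<omega> = d}"
  have "prob (?E 1 \<union> ?E 0 \<union> ?E (-1)) = prob (?E 1) + prob (?E 0) + prob (?E (-1))"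
    by (subst finite_measure_Union; (subst finite_measure_Union)?; auto)
  also have "\<dots> = 1" by (simp add: prob_D_up prob_D_stay prob_D_down algebra_simps)
  finally have "AE \<omega> in N. \<omega> \<in> ?E 1 \<union> ?E 0 \<union> ?E (-1)" by (rule AE_prob_1)
  then show ?thesis by eventually_elim auto
qed

text \<open>
  Up to a null set, the event \<open>X (Suc n) \<le> x\<close> arises from \<open>X n \<le> x\<close> by removing the moves
  from \<open>x\<close> to \<open>x + 1\<close> and adding the moves from \<open>x + 1\<close> to \<open>x\<close>.
\<close>

lemma pos_cdf_Suc: "pos_cdf (Suc n) x = acm_step m q r (pos_cdf n) x"
proof -
  let ?E = "{\<omega> \<in> space N. X n \<omega> \<le> x}" and ?U = "move_event n x 1" and ?L = "move_event n (x + 1) (-1)"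
  have "pos_cdf (Suc n) x = prob ((?E - ?U) \<union> ?L)"
    unfolding pos_cdf_def
  proof (rule finite_measure_eq_AE)
    show "AE \<omega> in N. \<omega> \<in> {\<omega> \<in> space N. X (Suc n) \<omega> \<le> x} \<longleftrightarrow> \<omega> \<in> (?E - ?U) \<union> ?L"
      using AE_displacement[of n] AE_space
    proof eventually_elim
      case (elim \<omega>)
      show ?case
      proof (cases "\<forall>i\<in>{1..m}. X n \<omega> = X' n i \<omega>")
        case True
        then have "X (Suc n) \<omega> = X n \<omega> + D n \<omega>" using X_Suc elim(2) by simp
        moreover have "\<omega> \<in> move_event n a d \<longleftrightarrow> X n \<omega> = a \<and> D n \<omega> = d" for a d
          using True elim(2) by (auto simp: move_event_def)
        ultimately show ?thesis using elim by auto
      next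
        case False
        then have "X (Suc n) \<omega> = X n \<omega>" using X_Suc elim(2) by (simp only: if_False)
        moreover have "\<omega> \<notin> move_event n a d" for a d
          using False by (auto simp: move_event_def)
        ultimately show ?thesis using elim by auto
      qed
    qed
  qed auto
  also have "\<dots> = prob (?E - ?U) + prob ?L"
  proof (rule finite_measure_Union)
    show "(?E - ?U) \<inter> ?L = {}" by (auto simp: move_event_def)
  qed auto
  also have "prob (?E - ?U) = prob ?E - prob ?U"
  proof (rule finite_measure_Diff)
    show "?U \<subseteq> ?E" by (auto simp: move_event_def)
  qed auto
  finally show ?thesis
    using prob_position[of n "x + 1"]
    by (simp add: prob_move_event prob_position prob_D_up prob_D_down acm_step_def pos_cdf_def[symmetric] mult.commute)
qed

lemma pos_cdf_mono: "mono (pos_cdf n)"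
  by (auto intro!: monoI finite_measure_mono simp: pos_cdf_def)

lemma
  shows pos_cdf_at_bot: "(pos_cdf n \<longlongrightarrow> 0) at_bot"
    and pos_cdf_at_top: "(pos_cdf n \<longlongrightarrow> 1) at_top"
proof -
  have meas: "(\<lambda>\<omega>. real_of_int (X n \<omega>)) \<in> borel_measurable N"
    using measurable_position by measurable
  define R where "R = distr N borel (\<lambda>\<omega>. real_of_int (X n \<omega>))"
  have R: "real_distribution R" unfolding R_def using meas by (rule real_distribution_distr)
  have eq: "pos_cdf n = (\<lambda>x. cdf R (real_of_int x))"
    using meas by (auto simp: R_def cdf_def measure_distr pos_cdf_def vimage_def Int_def conj_commute)
  have "filterlim real_of_int at_bot at_bot"
    unfolding filterlim_at_bot
  proof
    fix z :: real
    show "\<forall>\<^sub>F x in at_bot. real_of_int x \<le> z"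
      using eventually_le_at_bot[of "\<lfloor>z\<rfloor>"] by eventually_elim (simp add: le_floor_iff)
  qed
  then show "(pos_cdf n \<longlongrightarrow> 0) at_bot"
    unfolding eq using R by (intro filterlim_compose[OF finite_borel_measure.cdf_lim_at_bot])
      (auto simp: real_distribution.axioms real_distribution.finite_borel_measure_M)
  have "filterlim real_of_int at_top at_top"
    by (rule filterlim_real_of_int_at_top)
  then show "(pos_cdf n \<longlongrightarrow> 1) at_top"
    unfolding eq using R by (intro filterlim_compose[OF real_distribution.cdf_lim_at_top_prob])
qed

lemma initial_law_return_pmf:
  assumes "\<And>x. pos_cdf 0 x = (if x < k then 0 else 1)"
  shows "\<mu> = return_pmf k"
proof -
  have "pmf \<mu> k = measure (distr N (count_space UNIV) (X 0)) {k}"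
    by (simp add: distr_X_0 measure_pmf_single)
  also have "\<dots> = prob {\<omega> \<in> space N. X 0 \<omega> = k}"
    using measurable_position by (simp add: measure_distr vimage_def Int_def conj_commute)
  also have "\<dots> = 1" by (simp add: prob_position assms)
  finally have "set_pmf \<mu> \<subseteq> {k}"
    using measure_pmf.prob_eq_1[of "{k}" \<mu>] by (auto simp: measure_pmf_single AE_measure_pmf_iff)
  then show ?thesis by (simp add: set_pmf_subset_singleton)
qed

lemma acm_cdf_right:
  assumes "m \<ge> 1" "0 < q" "q \<le> 1" "1 / 2 < r" "r \<le> 1" "\<not> (q = 1 \<and> r = 1 \<and> (\<exists>k. \<mu> = return_pmf k))"
  shows "acm_cdf m q r pos_cdf"
proof
  show "\<not> (q = 1 \<and> r = 1 \<and> (\<exists>k. \<forall>x. pos_cdf 0 x = (if x < k then 0 else 1)))"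
    using assms initial_law_return_pmf by blast
qed (use assms in \<open>auto intro: pos_cdf_mono pos_cdf_at_bot pos_cdf_at_top pos_cdf_Suc\<close>)

lemma acm_cdf_left:
  assumes "m \<ge> 1" "0 < q" "q \<le> 1" "0 \<le> r" "r < 1 / 2" "\<not> (q = 1 \<and> r = 0 \<and> (\<exists>k. \<mu> = return_pmf k))"
  shows "acm_cdf m q (1 - r) (\<lambda>n x. 1 - pos_cdf n (- x - 1))"
proof
  fix n x
  show "mono (\<lambda>x. 1 - pos_cdf n (- x - 1))"
    by (auto intro!: monoI monoD[OF pos_cdf_mono])
  have bot: "filterlim (\<lambda>x::int. - x - 1) at_bot at_top"
    unfolding filterlim_at_bot
  proof
    fix z :: int
    show "\<forall>\<^sub>F x in at_top. - x - 1 \<le> z"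
      using eventually_ge_at_top[of "- z - 1"] by eventually_elim simp
  qed
  have top: "filterlim (\<lambda>x::int. - x - 1) at_top at_bot"
    unfolding filterlim_at_top
  proof
    fix z :: int
    show "\<forall>\<^sub>F x in at_bot. z \<le> - x - 1"
      using eventually_le_at_bot[of "- z - 1"] by eventually_elim simp
  qed
  have "((\<lambda>x. 1 - pos_cdf n (- x - 1)) \<longlongrightarrow> 1 - 1) at_bot"
    by (intro tendsto_intros filterlim_compose[OF pos_cdf_at_top top])
  then show "((\<lambda>x. 1 - pos_cdf n (- x - 1)) \<longlongrightarrow> 0) at_bot" by simp
  have "((\<lambda>x. 1 - pos_cdf n (- x - 1)) \<longlongrightarrow> 1 - 0) at_top"
    by (intro tendsto_intros filterlim_compose[OF pos_cdf_at_bot bot])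
  then show "((\<lambda>x. 1 - pos_cdf n (- x - 1)) \<longlongrightarrow> 1) at_top" by simp
  show "1 - pos_cdf (Suc n) (- x - 1) = acm_step m q (1 - r) (\<lambda>x. 1 - pos_cdf n (- x - 1)) x"
    by (simp add: acm_step_reflect pos_cdf_Suc)
  show "\<not> (q = 1 \<and> 1 - r = 1 \<and> (\<exists>k. \<forall>x. 1 - pos_cdf 0 (- x - 1) = (if x < k then 0 else 1)))"
  proof safe
    fix k assume q: "q = 1" "1 - r = 1"
      and k: "\<forall>x. 1 - pos_cdf 0 (- x - 1) = (if x < k then 0 else 1)"
    have "pos_cdf 0 x = (if x < - k then 0 else 1)" for x
      using k[rule_format, of "- x - 1"] by (simp split: if_splits)
    then have "\<mu> = return_pmf (- k)" by (rule initial_law_return_pmf)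
    then show False using assms q by auto
  qed
qed (use assms in auto)

end

text \<open>
  The conclusion of the theorem involves one marginal at a time, so a realisation can stand in for
  any process with the same law.
\<close>

lemma distr_position_eq:
  assumes "\<And>n. X n \<in> measurable M (count_space UNIV)" "\<And>n. Y n \<in> measurable N (count_space UNIV)"
    and "process_law M X = process_law N Y"
  shows "distr M (count_space UNIV) (X n) = distr N (count_space UNIV) (Y n)"
proof -
  have *: "distr P (count_space UNIV) (Z n) = distr (process_law P Z) (count_space UNIV) (\<lambda>f. f n)"
    if Z: "\<And>n. Z n \<in> measurable P (count_space UNIV)" for P :: "'c measure" and Z
  proof -
    have "(\<lambda>\<omega> n. Z n \<omega>) \<in> measurable P (\<Pi>\<^sub>M n\<in>UNIV. count_space UNIV)"
      by (rule measurable_PiM_single') (use Z in auto)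
    then show ?thesis unfolding process_law_def by (subst distr_distr) (auto simp: comp_def)
  qed
  show ?thesis using *[of X, OF assms(1)] *[of Y, OF assms(2)] assms(3) by simp
qed

theorem theorem1p1:
  fixes m :: nat and q r \<sigma> :: real and \<mu> :: "int pmf"
    and N :: "'b measure" and Y D :: "nat \<Rightarrow> 'b \<Rightarrow> int" and Y' :: "nat \<Rightarrow> nat \<Rightarrow> 'b \<Rightarrow> int"
    and M :: "'a measure" and X :: "nat \<Rightarrow> 'a \<Rightarrow> int"
  assumes m: "m \<ge> 1"
    and q: "0 < q" "q \<le> 1"
    and r: "0 \<le> r" "r \<le> 1" "r \<noteq> 1 / 2"
    and not_both_1: "\<not> (q = 1 \<and> r = 1)"
    and not_deterministic: "\<not> (q = 1 \<and> r = 0 \<and> (\<exists>k. \<mu> = return_pmf k))"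
    and \<sigma>: "\<sigma> = (2 * r - 1) * q"
    and acm: "acm_realisation N m q r \<mu> Y D Y'"
    and M: "prob_space M"
    and X_meas: "\<And>n. X n \<in> measurable M (count_space UNIV)"
    and X_law: "process_law M X = process_law N Y"
  shows "weak_conv_m
    (\<lambda>n. distr M borel (\<lambda>\<omega>. sgn \<sigma> / (real m + 1) * (real m ^ m / \<bar>\<sigma>\<bar>) powr (1 / (real m + 1))
            * (real_of_int (X n \<omega>) / real n powr (1 / (real m + 1)))))
    (beta1 ((real m + 1) / real m))"
proof -
  interpret N: acm_realisation N m q r \<mu> Y D Y' by (rule acm)
  define \<theta> where "\<theta> = (real m + 1) / real m"
  have \<theta>: "\<theta> > 0" using m by (simp add: \<theta>_def)
  define C where "C = 1 / (real m + 1) * (real m ^ m / \<bar>\<sigma>\<bar>) powr (1 / (real m + 1))"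
  have "\<sigma> \<noteq> 0" using \<sigma> q r by auto
  then have C: "C > 0" using m by (simp add: C_def)
  define h where "h n x = sgn \<sigma> / (real m + 1) * (real m ^ m / \<bar>\<sigma>\<bar>) powr (1 / (real m + 1))
            * (real_of_int x / real n powr (1 / (real m + 1)))" for n :: nat and x :: int
  have h: "h n x = sgn \<sigma> * C * (real_of_int x / real n powr (1 / (real m + 1)))" for n x
    by (simp add: h_def C_def)
  have "distr M borel (\<lambda>\<omega>. h n (X n \<omega>)) = distr N borel (\<lambda>\<omega>. h n (Y n \<omega>))" for n
  proof -
    have "distr M borel (\<lambda>\<omega>. h n (X n \<omega>)) = distr (distr M (count_space UNIV) (X n)) borel (h n)"
      using X_meas by (subst distr_distr) (auto simp: comp_def)
    also have "\<dots> = distr (distr N (count_space UNIV) (Y n)) borel (h n)"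
      using distr_position_eq[OF X_meas N.measurable_position X_law] by simp
    also have "\<dots> = distr N borel (\<lambda>\<omega>. h n (Y n \<omega>))"
      using N.measurable_position by (subst distr_distr) (auto simp: comp_def)
    finally show ?thesis .
  qed
  moreover have "(\<lambda>n. cdf (distr N borel (\<lambda>\<omega>. h n (Y n \<omega>))) z) \<longlonglongrightarrow> beta1_cdf \<theta> z" for z
  proof -
    define k where "k n = \<lfloor>z / C * real n powr (1 / (real m + 1))\<rfloor>" for n :: nat
    have cdf: "cdf (distr N borel (\<lambda>\<omega>. h n (Y n \<omega>))) z = N.prob {\<omega> \<in> space N. h n (Y n \<omega>) \<le> z}" for n
    proof -
      have "(\<lambda>\<omega>. h n (Y n \<omega>)) \<in> borel_measurable N"
        using N.measurable_position by (rule measurable_compose) simp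
      then show ?thesis by (simp add: cdf_def measure_distr vimage_def Int_def conj_commute)
    qed
    have le_iff: "C * (real_of_int x / real n powr (1 / (real m + 1))) \<le> z \<longleftrightarrow> x \<le> k n"
      if "n > 0" for n x
      using that C by (simp add: k_def le_floor_iff field_simps)
    show ?thesis
    proof (cases "r > 1 / 2")
      case True
      interpret F: acm_cdf m q r N.pos_cdf
        using m q r not_both_1 True by (intro N.acm_cdf_right) auto
      have "F.\<sigma> = \<sigma>" by (simp add: F.\<sigma>_def \<sigma>)
      moreover have "\<sigma> > 0" using True q by (simp add: \<sigma>)
      ultimately have scale: "F.scale = C" "sgn \<sigma> = 1" by (simp_all add: F.scale_def C_def)
      have "\<forall>\<^sub>F n in sequentially. N.pos_cdf n (k n) = cdf (distr N borel (\<lambda>\<omega>. h n (Y n \<omega>))) z"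
        using eventually_gt_at_top[of 0]
      proof eventually_elim
        case (elim n)
        have "h n y \<le> z \<longleftrightarrow> y \<le> k n" for y
          using le_iff[OF elim, of y] scale by (simp add: h)
        then show ?case unfolding cdf N.pos_cdf_def by simp
      qed
      moreover have "(\<lambda>n. N.pos_cdf n (k n)) \<longlonglongrightarrow> beta1_cdf \<theta> z"
        using F.F_rescaled_tendsto_beta1[of z] scale by (simp add: k_def \<theta>_def F.\<theta>_def)
      ultimately show ?thesis by (rule Lim_transform_eventually[rotated])
    next
      case False
      then have r': "r < 1 / 2" using r by simp
      interpret F: acm_cdf m q "1 - r" "\<lambda>n x. 1 - N.pos_cdf n (- x - 1)"
        using m q r r' not_deterministic by (intro N.acm_cdf_left) auto
      have "F.\<sigma> = - \<sigma>" by (simp add: F.\<sigma>_def \<sigma> algebra_simps)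
      moreover have "\<sigma> < 0" using r' q by (simp add: \<sigma> mult_less_0_iff)
      ultimately have scale: "F.scale = C" "sgn \<sigma> = -1" by (simp_all add: F.scale_def C_def)
      have "\<forall>\<^sub>F n in sequentially. 1 - N.pos_cdf n (- k n - 1) = cdf (distr N borel (\<lambda>\<omega>. h n (Y n \<omega>))) z"
        using eventually_gt_at_top[of 0]
      proof eventually_elim
        case (elim n)
        have "h n y \<le> z \<longleftrightarrow> \<not> y \<le> - k n - 1" for y
          using le_iff[OF elim, of "- y"] scale by (auto simp: h)
        then have "cdf (distr N borel (\<lambda>\<omega>. h n (Y n \<omega>))) z
            = N.prob (space N - {\<omega> \<in> space N. Y n \<omega> \<le> - k n - 1})"
          unfolding cdf by (intro arg_cong[of _ _ N.prob]) auto
        also have "\<dots> = 1 - N.pos_cdf n (- k n - 1)"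
          unfolding N.pos_cdf_def by (rule N.prob_compl) simp
        finally show ?case by simp
      qed
      moreover have "(\<lambda>n. 1 - N.pos_cdf n (- k n - 1)) \<longlonglongrightarrow> beta1_cdf \<theta> z"
        using F.F_rescaled_tendsto_beta1[of z] scale by (simp add: k_def \<theta>_def F.\<theta>_def)
      ultimately show ?thesis by (rule Lim_transform_eventually[rotated])
    qed
  qed
  ultimately show ?thesis
    unfolding weak_conv_m_def weak_conv_def
    using cdf_beta1[OF \<theta>] by (simp add: h_def \<theta>_def)
qed

end
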